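(* Let $\mathfrak{X}$ be a Banach space with the approximation property and let $B=\widetilde{\mathcal{K}(\mathfrak{X})}$ be the unitization of the algebra $\mathcal{K}(\mathfrak{X})$ of all compact operators on $\mathfrak{X}$. Then $\mathcal{N}_{Lie}(B)^2\subseteq\overline{\mathcal{T}_{Lie}(B)}$, where the closure is taken in the projective tensor product $B\hat{\otimes}B^{op}$.
   Context: Here "approximation property" is used in the sense that the compact operators on $\mathfrak{X}$ are norm-limits of finite-rank operators. $B^{op}$ denotes the opposite algebra (same linear space, product $a*b=ba$), $B\otimes B^{op}$ the algebraic tensor product algebra, regarded as a subalgebra of the Banach algebra $B\hat{\otimes}B^{op}$. $\mathcal{T}_{Lie}(B)$ is the subalgebra (not required to contain the unit) of $B\otimes B^{op}$ generated by all elements $a\otimes 1-1\otimes a$, $a\in B$. $\mathcal{N}_{Lie}(B)$ is the subalgebra of $B\otimes B^{op}$ consisting of all finite tensors $\sum_k a_k\otimes b_k$ such that $\sum_k a_kb_k=0$ and $\sum_k b_ka_k=0$, the products being taken in $B$. $\mathcal{N}_{Lie}(B)^2$ is the linear span of all products of two elements of $\mathcal{N}_{Lie}(B)$. *)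

theory Defs
  imports "HOL-Analysis.Analysis" "HOL-Library.Function_Algebras"
begin

section \<open>Banach spaces over the real or complex field\<close>

text \<open>
  The scalar field is a type \<open>'k\<close> of sort \<open>{real_normed_field, heine_borel}\<close>. Both \<^typ>\<open>real\<close> and
  \<^typ>\<open>complex\<close> are instances and, by the Gelfand--Mazur theorem, every instance is isomorphic to
  one of them. A Banach space over \<open>'k\<close> is a type of class \<^class>\<open>banach\<close> with a scalar
  multiplication by \<open>'k\<close> that extends \<^const>\<open>scaleR\<close> and satisfies the locale below.
\<close>

locale normed_space_over = vector_space sc
  for sc :: "'k::{real_normed_field, heine_borel} \<Rightarrow> 'x::real_normed_vector \<Rightarrow> 'x" +
  assumes scale_of_real: "sc (of_real r) x = r *\<^sub>R x"
    and norm_scale: "norm (sc c x) = norm c * norm x"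

text \<open>
  The type \<open>'x \<Rightarrow>\<^sub>L 'x\<close> consists of the bounded \<^emph>\<open>real\<close>-linear operators with the operator norm, so
  linearity over \<open>'k\<close> is imposed separately.
\<close>

definition bounded_operators ::
    "('k::{real_normed_field, heine_borel} \<Rightarrow> 'x::real_normed_vector \<Rightarrow> 'x) \<Rightarrow> ('x \<Rightarrow>\<^sub>L 'x) set" where
  "bounded_operators sc = {T. \<forall>c x. blinfun_apply T (sc c x) = sc c (blinfun_apply T x)}"

definition compact_operators ::
    "('k::{real_normed_field, heine_borel} \<Rightarrow> 'x::real_normed_vector \<Rightarrow> 'x) \<Rightarrow> ('x \<Rightarrow>\<^sub>L 'x) set" where
  "compact_operators sc =
    {T \<in> bounded_operators sc. compact (closure (blinfun_apply T ` cball 0 1))}"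

definition finite_rank_operators ::
    "('k::{real_normed_field, heine_borel} \<Rightarrow> 'x::real_normed_vector \<Rightarrow> 'x) \<Rightarrow> ('x \<Rightarrow>\<^sub>L 'x) set" where
  "finite_rank_operators sc =
    {T \<in> bounded_operators sc. \<exists>S. finite S \<and> range (blinfun_apply T) \<subseteq> module.span sc S}"

definition approximation_property ::
    "('k::{real_normed_field, heine_borel} \<Rightarrow> 'x::real_normed_vector \<Rightarrow> 'x) \<Rightarrow> bool" where
  "approximation_property sc \<longleftrightarrow> compact_operators sc \<subseteq> closure (finite_rank_operators sc)"


section \<open>Normed algebras, unitization, opposite algebra\<close>

text \<open>
  Normed algebras are given by a carrier set inside an additive group; addition and zero are those
  of the ambient type.
\<close>

record ('k, 'b) normed_alg =
  elems :: "'b set"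
  smul :: "'k \<Rightarrow> 'b \<Rightarrow> 'b"
  mul :: "'b \<Rightarrow> 'b \<Rightarrow> 'b"
  nrm :: "'b \<Rightarrow> real"

record ('k, 'b) unital_normed_alg = "('k, 'b) normed_alg" +
  unit_elem :: 'b

definition compact_operator_algebra ::
    "('k::{real_normed_field, heine_borel} \<Rightarrow> 'x::real_normed_vector \<Rightarrow> 'x)
      \<Rightarrow> ('k, 'x \<Rightarrow>\<^sub>L 'x) normed_alg" where
  "compact_operator_algebra sc =
    \<lparr>elems = compact_operators sc,
     smul = (\<lambda>c T. Blinfun (\<lambda>x. sc c (blinfun_apply T x))),
     mul = (\<lambda>S T. S o\<^sub>L T),
     nrm = norm\<rparr>"

text \<open>
  The pair \<open>(a, s)\<close> stands for \<open>a + s 1\<close>. A new unit is adjoined even if the algebra has one.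
\<close>

definition unitization ::
    "('k::real_normed_field, 'b::ab_group_add) normed_alg \<Rightarrow> ('k, 'b \<times> 'k) unital_normed_alg" where
  "unitization A =
    \<lparr>elems = elems A \<times> UNIV,
     smul = (\<lambda>c (a, s). (smul A c a, c * s)),
     mul = (\<lambda>(a, s) (b, t). (mul A a b + smul A s b + smul A t a, s * t)),
     nrm = (\<lambda>(a, s). nrm A a + norm s),
     unit_elem = (0, 1)\<rparr>"

definition opposite :: "('k, 'b, 'z) normed_alg_scheme \<Rightarrow> ('k, 'b, 'z) normed_alg_scheme" where
  "opposite A = A\<lparr>mul := (\<lambda>a b. mul A b a)\<rparr>"


section \<open>The algebraic tensor product\<close>

text \<open>
  The algebraic tensor product is realised as the space of those linear functionals on the space of
  bilinear forms that are finite sums of the evaluations \<open>a \<otimes> b: \<phi> \<mapsto> \<phi> a b\<close>. Functionals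
  are extended by \<open>0\<close> to functions that are not bilinear on the carriers.
\<close>

type_synonym ('k, 'b, 'c) functional = "('b \<Rightarrow> 'c \<Rightarrow> 'k) \<Rightarrow> 'k"

definition bilinear_form ::
    "('k::field, 'b::ab_group_add, 'y) normed_alg_scheme \<Rightarrow> ('k, 'c::ab_group_add, 'z) normed_alg_scheme
      \<Rightarrow> ('b \<Rightarrow> 'c \<Rightarrow> 'k) \<Rightarrow> bool" where
  "bilinear_form A C \<phi> \<longleftrightarrow>
    (\<forall>a\<in>elems A. \<forall>a'\<in>elems A. \<forall>c\<in>elems C. \<phi> (a + a') c = \<phi> a c + \<phi> a' c) \<and>
    (\<forall>a\<in>elems A. \<forall>c\<in>elems C. \<forall>c'\<in>elems C. \<phi> a (c + c') = \<phi> a c + \<phi> a c') \<and>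
    (\<forall>s. \<forall>a\<in>elems A. \<forall>c\<in>elems C. \<phi> (smul A s a) c = s * \<phi> a c \<and> \<phi> a (smul C s c) = s * \<phi> a c)"

definition tensor ::
    "('k::field, 'b::ab_group_add, 'y) normed_alg_scheme \<Rightarrow> ('k, 'c::ab_group_add, 'z) normed_alg_scheme
      \<Rightarrow> 'b \<Rightarrow> 'c \<Rightarrow> ('k, 'b, 'c) functional" where
  "tensor A C a c = (\<lambda>\<phi>. if bilinear_form A C \<phi> then \<phi> a c else 0)"

definition fun_scale :: "'k::field \<Rightarrow> ('k, 'b, 'c) functional \<Rightarrow> ('k, 'b, 'c) functional" where
  "fun_scale s u = (\<lambda>\<phi>. s * u \<phi>)"

definition alg_tensor_product ::
    "('k::field, 'b::ab_group_add, 'y) normed_alg_scheme \<Rightarrow> ('k, 'c::ab_group_add, 'z) normed_alg_scheme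
      \<Rightarrow> ('k, 'b, 'c) functional set" where
  "alg_tensor_product A C =
    {\<Sum>k<n. tensor A C (a k) (c k) | (n::nat) a c. \<forall>k<n. a k \<in> elems A \<and> c k \<in> elems C}"

text \<open>
  On elementary tensors, \<open>(a \<otimes> c) (a' \<otimes> c') = a a' \<otimes> c c'\<close>; the formula below is its
  bilinear extension.
\<close>

definition tensor_mult ::
    "('k::field, 'b::ab_group_add, 'y) normed_alg_scheme \<Rightarrow> ('k, 'c::ab_group_add, 'z) normed_alg_scheme
      \<Rightarrow> ('k, 'b, 'c) functional \<Rightarrow> ('k, 'b, 'c) functional \<Rightarrow> ('k, 'b, 'c) functional" where
  "tensor_mult A C u v =
    (\<lambda>\<phi>. if bilinear_form A C \<phi> then u (\<lambda>a c. v (\<lambda>a' c'. \<phi> (mul A a a') (mul C c c'))) else 0)"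

definition subalgebra ::
    "('k::field, 'b::ab_group_add, 'y) normed_alg_scheme \<Rightarrow> ('k, 'c::ab_group_add, 'z) normed_alg_scheme
      \<Rightarrow> ('k, 'b, 'c) functional set \<Rightarrow> bool" where
  "subalgebra A C S \<longleftrightarrow>
    S \<subseteq> alg_tensor_product A C \<and> module.subspace fun_scale S \<and>
    (\<forall>u\<in>S. \<forall>v\<in>S. tensor_mult A C u v \<in> S)"


section \<open>The projective tensor product\<close>

definition projective_norm ::
    "('k::field, 'b::ab_group_add, 'y) normed_alg_scheme \<Rightarrow> ('k, 'c::ab_group_add, 'z) normed_alg_scheme
      \<Rightarrow> ('k, 'b, 'c) functional \<Rightarrow> real" where
  "projective_norm A C u =
    Inf {\<Sum>k<n. nrm A (a k) * nrm C (c k) | (n::nat) a c.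
      (\<forall>k<n. a k \<in> elems A \<and> c k \<in> elems C) \<and> u = (\<Sum>k<n. tensor A C (a k) (c k))}"

text \<open>
  The completion of a normed space, with carrier \<open>V\<close> and norm \<open>p\<close>, by classes of Cauchy sequences.
\<close>

definition cauchy_seqs :: "'v::ab_group_add set \<Rightarrow> ('v \<Rightarrow> real) \<Rightarrow> (nat \<Rightarrow> 'v) set" where
  "cauchy_seqs V p =
    {X. (\<forall>n. X n \<in> V) \<and> (\<forall>e>0. \<exists>N. \<forall>m\<ge>N. \<forall>n\<ge>N. p (X m - X n) < e)}"

definition cauchy_rel ::
    "'v::ab_group_add set \<Rightarrow> ('v \<Rightarrow> real) \<Rightarrow> ((nat \<Rightarrow> 'v) \<times> (nat \<Rightarrow> 'v)) set" where
  "cauchy_rel V p =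
    {(X, Y) \<in> cauchy_seqs V p \<times> cauchy_seqs V p. (\<lambda>n. p (X n - Y n)) \<longlonglongrightarrow> 0}"

definition cauchy_completion :: "'v::ab_group_add set \<Rightarrow> ('v \<Rightarrow> real) \<Rightarrow> (nat \<Rightarrow> 'v) set set" where
  "cauchy_completion V p = cauchy_seqs V p // cauchy_rel V p"

definition completion_dist ::
    "'v::ab_group_add set \<Rightarrow> ('v \<Rightarrow> real) \<Rightarrow> (nat \<Rightarrow> 'v) set \<Rightarrow> (nat \<Rightarrow> 'v) set \<Rightarrow> real" where
  "completion_dist V p \<xi> \<eta> =
    (if \<xi> \<in> cauchy_completion V p \<and> \<eta> \<in> cauchy_completion V p
     then lim (\<lambda>n. p ((SOME X. X \<in> \<xi>) n - (SOME Y. Y \<in> \<eta>) n)) else 0)"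

definition completion_embed ::
    "'v::ab_group_add set \<Rightarrow> ('v \<Rightarrow> real) \<Rightarrow> 'v \<Rightarrow> (nat \<Rightarrow> 'v) set" where
  "completion_embed V p v = cauchy_rel V p `` {\<lambda>n. v}"

definition proj_tensor_topology ::
    "('k::field, 'b::ab_group_add, 'y) normed_alg_scheme \<Rightarrow> ('k, 'c::ab_group_add, 'z) normed_alg_scheme
      \<Rightarrow> (nat \<Rightarrow> ('k, 'b, 'c) functional) set topology" where
  "proj_tensor_topology A C =
    Metric_space.mtopology
      (cauchy_completion (alg_tensor_product A C) (projective_norm A C))
      (completion_dist (alg_tensor_product A C) (projective_norm A C))"

definition proj_tensor_embed ::
    "('k::field, 'b::ab_group_add, 'y) normed_alg_scheme \<Rightarrow> ('k, 'c::ab_group_add, 'z) normed_alg_scheme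
      \<Rightarrow> ('k, 'b, 'c) functional \<Rightarrow> (nat \<Rightarrow> ('k, 'b, 'c) functional) set" where
  "proj_tensor_embed A C = completion_embed (alg_tensor_product A C) (projective_norm A C)"


section \<open>The algebras of the theorem\<close>

definition T_Lie ::
    "('k::field, 'b::ab_group_add) unital_normed_alg \<Rightarrow> ('k, 'b, 'b) functional set" where
  "T_Lie B = subalgebra B (opposite B) hull
    {tensor B (opposite B) a (unit_elem B) - tensor B (opposite B) (unit_elem B) a | a. a \<in> elems B}"

definition N_Lie ::
    "('k::field, 'b::ab_group_add) unital_normed_alg \<Rightarrow> ('k, 'b, 'b) functional set" where
  "N_Lie B =
    {\<Sum>k<n. tensor B (opposite B) (a k) (b k) | (n::nat) a b.
      (\<forall>k<n. a k \<in> elems B \<and> b k \<in> elems B) \<and>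
      (\<Sum>k<n. mul B (a k) (b k)) = 0 \<and> (\<Sum>k<n. mul B (b k) (a k)) = 0}"

definition N_Lie_squared ::
    "('k::field, 'b::ab_group_add) unital_normed_alg \<Rightarrow> ('k, 'b, 'b) functional set" where
  "N_Lie_squared B =
    module.span fun_scale {tensor_mult B (opposite B) u v | u v. u \<in> N_Lie B \<and> v \<in> N_Lie B}"

end

theory Submission
  imports Defs
begin

text \<open>
  Let \<open>F\<close> be the algebra of finite rank operators. A tensor of \<open>B \<otimes> B\<^sup>o\<^sup>p\<close> acts on \<open>B\<close> by
  \<open>(a \<otimes> b) x = a x b\<close>; modulo \<open>T = T_Lie B\<close> the elements \<open>a \<circ> b = a \<otimes> b - 1 \<otimes> ab\<close> are
  antisymmetric in \<open>a, b\<close> and satisfy the identity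
  \<open>{a,b} \<circ> c + {a,c} \<circ> b + {b,c} \<circ> a = 0\<close> with \<open>{a,b} = ab + ba\<close>, which comes from products of three
  generators. On rank one operators these two relations force \<open>a \<circ> b\<close> to depend on the commutator
  \<open>[a, b]\<close> only, so every tensor \<open>\<Sum> a\<^sub>k \<otimes> b\<^sub>k\<close> over \<open>F + k 1\<close> with \<open>\<Sum> a\<^sub>k b\<^sub>k = 0 = \<Sum> b\<^sub>k a\<^sub>k\<close>
  lies in \<open>T\<close>.

  Approximating \<open>u, v \<in> N_Lie B\<close> by tensors over \<open>F + k 1\<close> destroys both equations, and only one of
  them can be restored by a small correction. This suffices for products: if \<open>\<Sum> b\<^sub>k a\<^sub>k = 0\<close> holds for
  \<open>u'\<close> and \<open>\<Sum> a\<^sub>k b\<^sub>k = 0\<close> for \<open>v'\<close>, then \<open>u' v'\<close> satisfies both.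
\<close>

text \<open>Membership in \<open>T\<close> is tested by linear functionals \<open>l\<close>
  vanishing on \<open>T\<close>, for which the form \<open>l (a \<circ> b)\<close> satisfies both
  relations exactly. If \<open>\<Sum> a\<^sub>k b\<^sub>k = 0\<close>, the tensor equals
  \<open>\<Sum> a\<^sub>k \<circ> b\<^sub>k\<close>; if moreover
  \<open>\<Sum> b\<^sub>k a\<^sub>k = 0\<close>, the commutators sum to 0, and so does any form that
  is a linear function of the commutator. Scalar parts are harmless: \<open>1 \<circ> b = 0\<close>,
  and \<open>a \<circ> 1\<close> is a generator of \<open>T\<close>.

  The obstacle is the approximation. Let P and Q be the two products, in either order, of an
  approximating tensor. Both are small, and adding \<open>1 \<otimes> (- P)\<close> cancels P but
  turns Q into Q - P. Cancelling this as well would require writing it through commutators with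
  control of the projective norm, which smallness in operator norm does not obviously provide. In a
  product of two tensors one equation each is enough, because \<open>c\<^sub>j d\<^sub>j\<close>
  stands in the middle of \<open>a\<^sub>i c\<^sub>j d\<^sub>j b\<^sub>i\<close> and
  \<open>b\<^sub>i a\<^sub>i\<close> in the middle of
  \<open>d\<^sub>j b\<^sub>i a\<^sub>i c\<^sub>j\<close>.

  The Hahn--Banach theorem supplies a bounded functional that separates a vector from its component
  along a reference vector.\<close>

section \<open>The Hahn--Banach theorem\<close>

definition sublinear :: "('x::real_vector \<Rightarrow> real) \<Rightarrow> bool" where
  "sublinear p \<longleftrightarrow> (\<forall>x y. p (x + y) \<le> p x + p y) \<and> (\<forall>t x. 0 \<le> t \<longrightarrow> p (t *\<^sub>R x) = t * p x)"

text \<open>Applying the one-sided bound to \<open>1 / t\<close> and \<open>t *\<^sub>R x\<close>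
  gives the reverse bound.\<close>

lemma sublinearI:
  assumes add: "\<And>x y. p (x + y) \<le> p x + p y"
    and zero: "p 0 = 0"
    and scale: "\<And>t x. 0 < t \<Longrightarrow> p (t *\<^sub>R x) \<le> t * p x"
  shows "sublinear p"
proof -
  have "p (t *\<^sub>R x) = t * p x" if "0 \<le> t" for t x
  proof (cases "t = 0")
    case True
    then show ?thesis by (simp add: zero)
  next
    case False
    then have t: "0 < t" using that by simp
    have "p ((1 / t) *\<^sub>R (t *\<^sub>R x)) \<le> (1 / t) * p (t *\<^sub>R x)"
      using t by (intro scale) simp
    then have "t * p x \<le> p (t *\<^sub>R x)"
      using t by (simp add: field_simps)
    with scale[OF t] show ?thesis by (intro antisym)
  qed
  with add show ?thesis by (simp add: sublinear_def)
qed

lemma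
  assumes "sublinear p"
  shows sublinear_add: "p (x + y) \<le> p x + p y"
    and sublinear_scale: "0 \<le> t \<Longrightarrow> p (t *\<^sub>R x) = t * p x"
    and sublinear_zero: "p 0 = 0"
    and sublinear_minus: "- p (- x) \<le> p x"
proof -
  show add: "p (x + y) \<le> p x + p y" for x y
    using assms by (simp add: sublinear_def)
  show "0 \<le> t \<Longrightarrow> p (t *\<^sub>R x) = t * p x"
    using assms by (simp add: sublinear_def)
  show zero: "p 0 = 0"
    using assms[unfolded sublinear_def] by (metis mult_zero_left order_refl scaleR_zero_left)
  show "- p (- x) \<le> p x"
    using add[of x "- x"] zero by simp
qed

text \<open>This lowers \<open>p\<close> at \<open>- w\<close> as far as sublinearity permits and is
  the improvement step of the Zorn argument. The infimum of
  \<open>p (x + t *\<^sub>R w) - t * p w\<close> over nonnegative \<open>t\<close> is at most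
  \<open>p x\<close> (take \<open>t = 0\<close>) and at \<open>- w\<close> at most
  \<open>- p w\<close> (take \<open>t = 1\<close>). It is finite because
  \<open>t * p w = p (t *\<^sub>R w)\<close> is bounded by
  \<open>p (x + t *\<^sub>R w) + p (- x)\<close>.\<close>

lemma sublinear_decrease:
  assumes p: "sublinear p"
  obtains q where "sublinear q" "\<And>x. q x \<le> p x" "q (- w) \<le> - p w"
proof -
  define f where "f x t = p (x + t *\<^sub>R w) - t * p w" for x t
  define q where "q x = (INF t\<in>{0..}. f x t)" for x
  have lower: "- p (- x) \<le> f x t" if "0 \<le> t" for x t
    using sublinear_add[OF p, of "x + t *\<^sub>R w" "- x"] sublinear_scale[OF p that, of w]
    by (simp add: f_def)
  have bdd: "bdd_below (f x ` {0..})" for x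
    using lower by (intro bdd_belowI2[where m = "- p (- x)"]) auto
  have le: "q x \<le> f x t" if "0 \<le> t" for x t
    unfolding q_def using that by (intro cINF_lower bdd) simp
  have ge: "c \<le> q x" if "\<And>t. 0 \<le> t \<Longrightarrow> c \<le> f x t" for c x
    unfolding q_def using that by (intro cINF_greatest) auto
  have "sublinear q"
  proof (rule sublinearI)
    fix x y
    have "q (x + y) \<le> f x s + f y t" if "0 \<le> s" "0 \<le> t" for s t
    proof -
      have "q (x + y) \<le> f (x + y) (s + t)"
        using that by (intro le) simp
      also have "\<dots> \<le> f x s + f y t"
        using sublinear_add[OF p, of "x + s *\<^sub>R w" "y + t *\<^sub>R w"]
        by (simp add: f_def algebra_simps)
      finally show ?thesis .
    qed
    then have "q (x + y) - f x s \<le> q y" if "0 \<le> s" for s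
      using that by (intro ge) (simp add: algebra_simps)
    then have "q (x + y) - q y \<le> q x"
      by (intro ge) (simp add: algebra_simps)
    then show "q (x + y) \<le> q x + q y" by simp
  next
    show "q 0 = 0"
      using le[of 0 0] ge[of 0 0] lower[of _ 0] sublinear_zero[OF p] by (intro antisym) (simp_all add: f_def)
  next
    fix t :: real and x assume t: "0 < t"
    have "q (t *\<^sub>R x) / t \<le> f x s" if "0 \<le> s" for s
    proof -
      have "q (t *\<^sub>R x) \<le> f (t *\<^sub>R x) (t * s)"
        using t that by (intro le) simp
      also have "\<dots> = t * f x s"
        using sublinear_scale[OF p, of t "x + s *\<^sub>R w"] t by (simp add: f_def algebra_simps)
      finally show ?thesis
        using t by (simp add: field_simps)
    qed
    then have "q (t *\<^sub>R x) / t \<le> q x" by (rule ge)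
    then show "q (t *\<^sub>R x) \<le> t * q x"
      using t by (simp add: field_simps)
  qed
  moreover have "q x \<le> p x" for x
    using le[of 0 x] by (simp add: f_def)
  moreover have "q (- w) \<le> - p w"
    using le[of 1 "- w"] sublinear_zero[OF p] by (simp add: f_def)
  ultimately show ?thesis by (rule that)
qed

text \<open>A minimal sublinear function \<open>m\<close> cannot be changed by
  \<open>sublinear_decrease\<close>, so \<open>m (- x) \<le> - m x\<close>. Hence \<open>m\<close>
  is odd, and an odd sublinear function is linear.\<close>

lemma linear_below_sublinear:
  fixes p :: "'x::real_vector \<Rightarrow> real"
  assumes p: "sublinear p"
  obtains \<phi> where "linear \<phi>" "\<And>x. \<phi> x \<le> p x"
proof -
  define A where "A = {q. sublinear q \<and> q \<le> p}"
  have "\<exists>m\<in>A. \<forall>a\<in>A. a \<le> m \<longrightarrow> a = m"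
  \<comment> \<open>Zorn's lemma produces maximal elements; the order is reversed to obtain a
    minimal one.\<close>
  proof (rule predicate_Zorn)
    show "partial_order_on A (relation_of (\<lambda>a b. b \<le> a) A)"
      by (rule partial_order_on_relation_ofI) auto
  next
    fix C assume C: "C \<in> Chains (relation_of (\<lambda>a b. b \<le> a) A)"
    then have CA: "C \<subseteq> A" and tot: "\<And>a b. a \<in> C \<Longrightarrow> b \<in> C \<Longrightarrow> a \<le> b \<or> b \<le> a"
      by (auto simp: Chains_def relation_of_def)
    show "\<exists>u\<in>A. \<forall>a\<in>C. u \<le> a"
    proof (cases "C = {}")
      case True
      then show ?thesis using p by (auto simp: A_def)
    next
      case False
      define u where "u x = (INF q\<in>C. q x)" for x
      have sub: "sublinear q" and qp: "q x \<le> p x" if "q \<in> C" for q x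
        using CA that by (auto simp: A_def le_fun_def)
      have "- p (- x) \<le> q x" if "q \<in> C" for q x
        using sublinear_minus[OF sub[OF that], of x] qp[OF that, of "- x"] by linarith
      then have bdd: "bdd_below ((\<lambda>q. q x) ` C)" for x
        by (intro bdd_belowI2[where m = "- p (- x)"])
      have le: "u x \<le> q x" if "q \<in> C" for q x
        unfolding u_def using that by (intro cINF_lower bdd)
      have ge: "c \<le> u x" if "\<And>q. q \<in> C \<Longrightarrow> c \<le> q x" for c x
        unfolding u_def using that False by (intro cINF_greatest) auto
      have "sublinear u"
      proof (rule sublinearI)
        fix x y
        \<comment> \<open>The chain contains an \<open>s\<close> below both \<open>q\<close> and
          \<open>r\<close>, so a single sublinear function controls both infima.\<close>
        have "u (x + y) \<le> q x + r y" if qr: "q \<in> C" "r \<in> C" for q r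
        proof -
          obtain s where s: "s \<in> C" "s \<le> q" "s \<le> r"
            using tot[OF qr] qr by blast
          have "u (x + y) \<le> s x + s y"
            using le[OF s(1), of "x + y"] sublinear_add[OF sub[OF s(1)], of x y] by linarith
          with s(2,3) show ?thesis
            by (smt (verit) le_funD)
        qed
        then have "u (x + y) - q x \<le> r y" if "q \<in> C" "r \<in> C" for q r
          using that by (metis add.commute diff_le_eq)
        then have "u (x + y) - q x \<le> u y" if "q \<in> C" for q
          using that by (intro ge)
        then have "u (x + y) - u y \<le> q x" if "q \<in> C" for q
          using that by (metis add.commute diff_le_eq)
        then have "u (x + y) - u y \<le> u x"
          by (rule ge)
        then show "u (x + y) \<le> u x + u y" by simp
      next
        show "u 0 = 0"
          using False le[of _ 0] ge[of 0 0] sublinear_zero[OF sub] by (metis all_not_in_conv antisym order_refl)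
      next
        fix t :: real and x assume t: "0 < t"
        have "u (t *\<^sub>R x) / t \<le> q x" if "q \<in> C" for q
          using le[OF that, of "t *\<^sub>R x"] sublinear_scale[OF sub[OF that], of t x] t
          by (simp add: field_simps)
        then have "u (t *\<^sub>R x) / t \<le> u x" by (rule ge)
        then show "u (t *\<^sub>R x) \<le> t * u x"
          using t by (simp add: field_simps)
      qed
      moreover have "u \<le> p"
        using False le qp unfolding le_fun_def by (meson all_not_in_conv order_trans)
      ultimately show ?thesis
        using le by (auto simp: A_def le_fun_def)
    qed
  qed
  then obtain m where m: "sublinear m" "m \<le> p"
    and min: "\<And>q. sublinear q \<Longrightarrow> q \<le> m \<Longrightarrow> q = m"
    unfolding A_def by (blast intro: order_trans)
  have neg: "m (- x) = - m x" for x
  proof -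
    obtain q where q: "sublinear q" "\<And>y. q y \<le> m y" "q (- x) \<le> - m x"
      using sublinear_decrease[OF m(1), where w = x] by blast
    then have "q = m" by (intro min) (auto simp: le_fun_def)
    with q(3) sublinear_minus[OF m(1), of x] show ?thesis by simp
  qed
  have "linear m"
  proof (rule linearI)
    fix x y
    show "m (x + y) = m x + m y"
      using sublinear_add[OF m(1), of x y] sublinear_add[OF m(1), of "- x" "- y"]
        neg[of x] neg[of y] neg[of "x + y"] by simp
  next
    fix c x
    show "m (c *\<^sub>R x) = c *\<^sub>R m x"
      using sublinear_scale[OF m(1), of c x] sublinear_scale[OF m(1), of "- c" x]
        neg[of "c *\<^sub>R x"] by (cases "0 \<le> c") auto
  qed
  then show ?thesis
    using m(2) by (intro that) (auto simp: le_fun_def)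
qed

text \<open>The norm is first lowered to a \<open>q\<close> with
  \<open>q (- w) \<le> - norm w\<close>; every linear function below \<open>q\<close> then satisfies
  \<open>\<phi> w \<ge> norm w\<close>.\<close>

lemma real_functional_nonzero:
  fixes w :: "'x::real_normed_vector"
  assumes "w \<noteq> 0"
  obtains \<phi> :: "'x \<Rightarrow> real" where "bounded_linear \<phi>" "\<phi> w \<noteq> 0"
proof -
  have "sublinear (norm :: 'x \<Rightarrow> real)"
    by (simp add: sublinear_def norm_triangle_ineq)
  from sublinear_decrease[OF this, where w = w] obtain q where
    q: "sublinear q" "\<And>x. q x \<le> norm x" "q (- w) \<le> - norm w" by blast
  from linear_below_sublinear[OF q(1)] obtain \<phi> where
    \<phi>: "linear \<phi>" "\<And>x. \<phi> x \<le> q x" by blast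
  interpret linear \<phi> by fact
  have "\<phi> x \<le> norm x" for x
    using \<phi>(2)[of x] q(2)[of x] by linarith
  from this this[of "- _"] have "norm (\<phi> x) \<le> norm x * 1" for x
    by (simp add: abs_le_iff neg)
  then have "bounded_linear \<phi>"
    by unfold_locales blast
  moreover have "\<phi> w \<noteq> 0"
    using \<phi>(2)[of "- w"] q(3) zero_less_norm_iff[of w] assms neg[of w] by linarith
  ultimately show ?thesis by (rule that)
qed

section \<open>Finite-dimensional subspaces and functionals\<close>

context normed_space_over
begin

text \<open>By homogeneity, \<open>norm (m + sc c v)\<close> is \<open>norm c\<close> times the
  distance of \<open>v\<close> from a point of \<open>S\<close>. So the coefficient of
  \<open>v\<close> is controlled by the norm; this gives both the closedness of finite-dimensional
  subspaces and the boundedness of coordinate functionals.\<close>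

lemma scale_gap:
  assumes S: "closed S" "subspace S" and v: "v \<notin> S"
  obtains d where "0 < d" "\<And>c m. m \<in> S \<Longrightarrow> norm c * d \<le> norm (m + sc c v)"
proof
  have ne: "S \<noteq> {}" using subspace_0[OF S(2)] by auto
  show "0 < infdist v S"
    using infdist_pos_not_in_closed[OF S(1) ne v] .
  fix c m assume m: "m \<in> S"
  show "norm c * infdist v S \<le> norm (m + sc c v)"
  proof (cases "c = 0")
    case True
    then show ?thesis by simp
  next
    case False
    have "- sc (inverse c) m \<in> S"
      using S(2) m by (intro subspace_neg subspace_scale)
    then have "infdist v S \<le> dist v (- sc (inverse c) m)"
      by (rule infdist_le)
    then have "norm c * infdist v S \<le> norm c * norm (v + sc (inverse c) m)"
      by (intro mult_left_mono) (simp_all add: dist_norm)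
    also have "\<dots> = norm (sc c (v + sc (inverse c) m))"
      by (simp add: norm_scale)
    also have "sc c (v + sc (inverse c) m) = m + sc c v"
      using False by (simp add: scale_right_distrib)
    finally show ?thesis .
  qed
qed

lemma bounded_linear_scale: "bounded_linear (sc c)"
proof
  show "sc c (x + y) = sc c x + sc c y" for x y
    by (rule scale_right_distrib)
  show "sc c (r *\<^sub>R x) = r *\<^sub>R sc c x" for r x
    unfolding scale_of_real[symmetric] by (simp add: mult.commute)
  show "\<exists>K. \<forall>x. norm (sc c x) \<le> norm x * K"
    by (intro exI[of _ "norm c"]) (simp add: norm_scale)
qed

lemma bounded_linear_scale_left: "bounded_linear (\<lambda>c. sc c x)"
proof
  show "sc (a + b) x = sc a x + sc b x" for a b
    by (rule scale_left_distrib)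
  show "sc (r *\<^sub>R a) x = r *\<^sub>R sc a x" for r a
    unfolding scale_of_real[symmetric] by (simp add: scaleR_conv_of_real)
  show "\<exists>K. \<forall>a. norm (sc a x) \<le> norm a * K"
    by (intro exI[of _ "norm x"]) (simp add: norm_scale)
qed

text \<open>Along a convergent sequence the coefficients of the new vector are Cauchy by
  \<open>scale_gap\<close>, hence convergent in \<open>'k\<close>; subtracting their contribution
  leaves a convergent sequence in the smaller span, which is closed by induction.\<close>

lemma closed_span_finite:
  assumes "finite S"
  shows "closed (span S)"
  using assms
proof (induction S)
  case empty
  then show ?case by simp
next
  case (insert v S)
  show ?case
  proof (cases "v \<in> span S")
    case True
    then show ?thesis using insert.IH by (simp add: span_redundant)
  next
    case False
    obtain d where d: "0 < d" "\<And>c m. m \<in> span S \<Longrightarrow> norm c * d \<le> norm (m + sc c v)"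
      using scale_gap[OF insert.IH subspace_span False] by blast
    show ?thesis
      unfolding closed_sequential_limits
    proof (intro allI impI, elim conjE)
      fix z l assume z: "\<forall>n. z n \<in> span (insert v S)" and l: "z \<longlonglongrightarrow> l"
      obtain c where c: "\<And>n. z n - sc (c n) v \<in> span S"
      proof -
        have "\<exists>c. z n - sc c v \<in> span S" for n
          using z unfolding span_insert by (elim allE[of _ n]) simp
        then show ?thesis using that by metis
      qed
      have le: "norm (c m - c n) * d \<le> norm (z m - z n)" for m n
        using d(2)[OF span_diff[OF c[of m] c[of n]], of "c m - c n"]
        by (simp add: scale_left_diff_distrib)
      have "Cauchy c"
      proof (rule metric_CauchyI)
        fix e :: real assume "0 < e"
        then have "0 < e * d" using d(1) by simp
        with LIMSEQ_imp_Cauchy[OF l] obtain N where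
          N: "\<And>m n. m \<ge> N \<Longrightarrow> n \<ge> N \<Longrightarrow> norm (z m - z n) < e * d"
          unfolding Cauchy_iff by blast
        have "dist (c m) (c n) < e" if "m \<ge> N" "n \<ge> N" for m n
        proof -
          have "norm (c m - c n) * d < e * d"
            using le[of m n] N[OF that] by linarith
          then show ?thesis using d(1) by (simp add: dist_norm)
        qed
        then show "\<exists>M. \<forall>m\<ge>M. \<forall>n\<ge>M. dist (c m) (c n) < e" by blast
      qed
      then obtain b where b: "c \<longlonglongrightarrow> b"
        using Cauchy_convergent convergent_def by blast
      have "(\<lambda>n. z n - sc (c n) v) \<longlonglongrightarrow> l - sc b v"
        by (intro tendsto_diff l bounded_linear.tendsto[OF bounded_linear_scale_left] b)
      then have "l - sc b v \<in> span S"
        using closed_sequentially[of "span S" "\<lambda>n. z n - sc (c n) v"] insert.IH c by simp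
      then show "l \<in> span (insert v S)"
        unfolding span_insert by blast
    qed
  qed
qed

end

lemma normed_space_over_scaleR:
  "normed_space_over (scaleR :: real \<Rightarrow> 'x::real_normed_vector \<Rightarrow> 'x)"
  by unfold_locales (simp_all add: algebra_simps)

lemma closed_real_span_finite:
  fixes S :: "'x::real_normed_vector set"
  assumes "finite S"
  shows "closed (span S)"
  using normed_space_over.closed_span_finite[OF normed_space_over_scaleR assms]
  by (simp add: span_raw_def)

text \<open>Riesz's argument. A finite set \<open>S\<close> comes within 1/2 of every point of the
  unit ball. If \<open>y\<close> had a nearest point \<open>v\<close> in \<open>span S\<close> at
  distance \<open>r > 0\<close>, then adding to \<open>v\<close> the \<open>r\<close>-fold of a
  point of \<open>S\<close> close to the unit vector in direction \<open>y - v\<close> would come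
  within \<open>r / 2\<close> of \<open>y\<close>.\<close>

lemma heine_borel_finite_span:
  obtains S :: "'k::{real_normed_vector, heine_borel} set" where "finite S" "span S = UNIV"
proof -
  have "compact (cball (0::'k) 1)"
    by simp
  then have "\<forall>e>0. \<exists>S. finite S \<and> cball (0::'k) 1 \<subseteq> (\<Union>s\<in>S. ball s e)"
    using compact_eq_totally_bounded by blast
  from this[rule_format, of "1/2"]
  obtain S where S: "finite S" "cball (0::'k) 1 \<subseteq> (\<Union>s\<in>S. ball s (1/2))"
    by auto
  have "y \<in> span S" for y
  proof (rule ccontr)
    assume y: "y \<notin> span S"
    define d where "d = infdist y (span S)"
    have ne: "span S \<noteq> {}" using span_zero by blast
    have "0 < d"
      unfolding d_def using infdist_pos_not_in_closed[OF closed_real_span_finite[OF S(1)] ne y] .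
    obtain v where v: "v \<in> span S" "d = dist y v"
      using infdist_attains_inf[OF closed_real_span_finite[OF S(1)] ne, of y]
      unfolding d_def by blast
    define r where "r = norm (y - v)"
    have r: "0 < r" "r < 2 * d"
      using v(2) \<open>0 < d\<close> by (simp_all add: r_def dist_norm)
    have "(1 / r) *\<^sub>R (y - v) \<in> cball 0 1"
      using r by (simp add: r_def)
    then have "(1 / r) *\<^sub>R (y - v) \<in> (\<Union>s\<in>S. ball s (1/2))"
      using S(2) by (rule rev_subsetD)
    then obtain s where s: "s \<in> S" "norm ((1 / r) *\<^sub>R (y - v) - s) < 1/2"
      by (metis UN_E dist_commute dist_norm mem_ball)
    have "d \<le> dist y (v + r *\<^sub>R s)"
      unfolding d_def using v(1) s(1) by (intro infdist_le span_add span_scale) (auto intro: span_base)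
    also have "\<dots> = norm (r *\<^sub>R ((1 / r) *\<^sub>R (y - v) - s))"
      using r by (simp add: dist_norm algebra_simps)
    also have "\<dots> = r * norm ((1 / r) *\<^sub>R (y - v) - s)"
      using r by simp
    also have "\<dots> < r * (1/2)"
      using r s(2) by (intro mult_strict_left_mono)
    finally show False using r by simp
  qed
  with S(1) show ?thesis by (intro that[of S]) auto
qed

text \<open>This prepares the passage from real functionals to functionals over \<open>'k\<close>
  for both kinds of scalars at once; \<open>lam\<close> takes the place of the real part. The
  pairing \<open>lam (d * c)\<close> is nondegenerate, because a nonzero \<open>d\<close> is
  invertible and \<open>lam 1 = 1\<close>, so on the finite-dimensional space \<open>'k\<close> it
  represents every real linear functional.\<close>

lemma real_functional_representation:
  obtains lam :: "'k::{real_normed_field, heine_borel} \<Rightarrow> real" and e :: "'k \<Rightarrow> 'k" and B :: "'k set"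
  where "\<forall>d. (\<forall>c. lam (d * c) = 0) \<longrightarrow> d = 0" "linear lam"
    "\<forall>\<psi> c. linear \<psi> \<longrightarrow> \<psi> c = lam ((\<Sum>b\<in>B. \<psi> b *\<^sub>R e b) * c)"
proof -
  obtain S :: "'k set" where S: "finite S" "span S = UNIV"
    by (rule heine_borel_finite_span)
  obtain B where B: "B \<subseteq> S" "independent B" "S \<subseteq> span B"
    using maximal_independent_subset[of S] by blast
  have fin: "finite B" using B(1) S(1) by (rule finite_subset)
  have spanB: "span B = UNIV"
    using span_mono[OF B(3)] S(2) by (simp add: span_span top.extremum_unique)
  interpret fd: finite_dimensional_vector_space scaleR B
    rewrites "module.span scaleR = span" and "module.dependent scaleR = dependent"
      and "Vector_Spaces.linear scaleR scaleR = linear"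
    using fin B(2) spanB
    by (unfold_locales) (auto simp: span_raw_def dependent_raw_def linear_def real_scaleR_def)
  have "independent {1::'k}" by simp
  from linear_independent_extend[OF this, of "\<lambda>_. 1 :: real"]
  obtain lam :: "'k \<Rightarrow> real" where lam: "linear lam" "lam 1 = 1" by auto
  interpret lam: linear lam by fact
  have lam_mult: "linear (\<lambda>c. lam (d * c))" for d
    by (intro linearI) (simp_all add: distrib_left lam.add lam.scale)
  have zero: "d = 0" if "\<forall>c. lam (d * c) = 0" for d
    using spec[OF that, of "inverse d"] lam(2) by (cases "d = 0") auto
  \<comment> \<open>\<open>M d\<close> encodes the values of \<open>lam (d * c)\<close> on the basis
    as coordinates. It is injective, hence onto by dimension, and \<open>e b\<close> represents the
    coordinate functional of \<open>b\<close>.\<close>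
  define M where "M d = (\<Sum>b\<in>B. lam (d * b) *\<^sub>R b)" for d
  have linM: "linear M"
    unfolding M_def
    by (intro linearI)
      (simp_all add: distrib_right lam.add lam.scale scaleR_add_left sum.distrib scaleR_sum_right)
  have coeff: "lam (d * c) = \<psi> c" if "linear \<psi>" "M d = (\<Sum>b\<in>B. \<psi> b *\<^sub>R b)" for d \<psi> c
  proof -
    have "(\<Sum>b\<in>B. (lam (d * b) - \<psi> b) *\<^sub>R b) = 0"
      using that(2) by (simp add: M_def scaleR_left_diff_distrib sum_subtractf)
    then have "lam (d * b) - \<psi> b = 0" if "b \<in> B" for b
      using independentD[OF B(2) fin order_refl, of "\<lambda>b. lam (d * b) - \<psi> b"] that by blast
    then show ?thesis
      using linear_eq_on_span[OF lam_mult[of d] that(1), of B c] spanB by simp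
  qed
  have "inj M"
    unfolding linear_injective_0[OF linM]
  proof (intro allI impI)
    fix d assume "M d = 0"
    then have "lam (d * c) = 0" for c
      by (intro coeff[of "\<lambda>_. 0"]) (simp_all add: linear_zero)
    then show "d = 0" by (intro zero allI)
  qed
  then have "surj M"
    using fd.linear_inj_imp_surj[OF linM] by simp
  define e where "e = inv M"
  interpret M: linear M by (fact linM)
  have e: "M (e b) = b" for b
    unfolding e_def by (rule surj_f_inv_f) fact
  have "\<psi> c = lam ((\<Sum>b\<in>B. \<psi> b *\<^sub>R e b) * c)" if "linear \<psi>" for \<psi> :: "'k \<Rightarrow> real" and c
    by (intro coeff[symmetric] that) (simp add: M.sum M.scale e)
  with zero lam(1) show ?thesis
    by (intro that[of lam e B]) simp_all
qed

definition bounded_functionals ::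
    "('k::{real_normed_field, heine_borel} \<Rightarrow> 'x::real_normed_vector \<Rightarrow> 'x) \<Rightarrow> ('x \<Rightarrow> 'k) set" where
  "bounded_functionals sc =
    {f. (\<forall>x y. f (x + y) = f x + f y) \<and> (\<forall>c x. f (sc c x) = c * f x) \<and>
      (\<exists>C. \<forall>x. norm (f x) \<le> C * norm x)}"

context normed_space_over
begin

lemma bounded_functionalsI:
  assumes "\<And>x y. f (x + y) = f x + f y" "\<And>c x. f (sc c x) = c * f x"
    "\<And>x. norm (f x) \<le> C * norm x"
  shows "f \<in> bounded_functionals sc"
  using assms by (auto simp: bounded_functionals_def)

lemma
  assumes "f \<in> bounded_functionals sc"
  shows functional_add: "f (x + y) = f x + f y"
    and functional_scale: "f (sc c x) = c * f x"
    and functional_bounded_linear: "bounded_linear f"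
proof -
  show add: "f (x + y) = f x + f y" and scale: "f (sc c x) = c * f x" for c x y
    using assms by (simp_all add: bounded_functionals_def)
  obtain C where C: "\<And>x. norm (f x) \<le> C * norm x"
    using assms by (auto simp: bounded_functionals_def)
  show "bounded_linear f"
  proof
    show "f (r *\<^sub>R x) = r *\<^sub>R f x" for r x
      using scale[of "of_real r" x] by (simp add: scale_of_real scaleR_conv_of_real)
    show "\<exists>K. \<forall>x. norm (f x) \<le> norm x * K"
      using C by (auto simp: mult.commute)
  qed (rule add)
qed

text \<open>For complex scalars this is the familiar \<open>\<phi> x - i \<phi> (i x)\<close>. In
  general \<open>\<phi> (sc c x)\<close> is real linear in \<open>c\<close>, hence equal to
  \<open>lam (h x * c)\<close> for exactly one \<open>h x\<close>, and uniqueness makes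
  \<open>h\<close> linear over \<open>'k\<close>.\<close>

lemma functional_nonzero:
  assumes "w \<noteq> 0"
  obtains h where "h \<in> bounded_functionals sc" "h w \<noteq> 0"
proof -
  obtain \<phi> :: "'x \<Rightarrow> real" where \<phi>: "bounded_linear \<phi>" "\<phi> w \<noteq> 0"
    by (rule real_functional_nonzero[OF assms])
  interpret \<phi>: bounded_linear \<phi> by fact
  obtain lam :: "'k \<Rightarrow> real" and e B where
    inj: "\<forall>d. (\<forall>c. lam (d * c) = 0) \<longrightarrow> d = 0" and lin: "linear lam"
    and rep: "\<forall>\<psi> c. linear \<psi> \<longrightarrow> \<psi> c = lam ((\<Sum>b\<in>B. \<psi> b *\<^sub>R e b) * c)"
    by (rule real_functional_representation)
  interpret lam: linear lam by fact
  define h where "h x = (\<Sum>b\<in>B. \<phi> (sc b x) *\<^sub>R e b)" for x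
  have lam_h: "lam (h x * c) = \<phi> (sc c x)" for x c
    unfolding h_def
    by (rule rep[rule_format, of "\<lambda>c. \<phi> (sc c x)", symmetric])
      (intro bounded_linear.linear bounded_linear_compose[OF \<phi>(1)] bounded_linear_scale_left)
  have eqI: "d = d'" if "\<And>c. lam (d * c) = lam (d' * c)" for d d'
    using inj[rule_format, of "d - d'"] that by (simp add: left_diff_distrib lam.diff)
  obtain K where K: "\<And>x. norm (\<phi> x) \<le> norm x * K"
    using \<phi>.bounded by blast
  have "h \<in> bounded_functionals sc"
  proof (rule bounded_functionalsI)
    show "h (x + y) = h x + h y" for x y
      by (rule eqI) (simp add: lam_h distrib_right lam.add scale_right_distrib \<phi>.add)
    show "h (sc c x) = c * h x" for c x
    proof (rule eqI)
      fix b
      have "lam (c * h x * b) = lam (h x * (b * c))"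
        by (simp add: ac_simps)
      then show "lam (h (sc c x) * b) = lam (c * h x * b)"
        by (simp add: lam_h)
    qed
    show "norm (h x) \<le> (\<Sum>b\<in>B. norm b * K * norm (e b)) * norm x" for x
    proof -
      have "norm (h x) \<le> (\<Sum>b\<in>B. norm (\<phi> (sc b x) *\<^sub>R e b))"
        unfolding h_def by (rule norm_sum)
      also have "\<dots> \<le> (\<Sum>b\<in>B. (norm b * norm x * K) * norm (e b))"
        using K[of "sc _ x"] by (intro sum_mono) (simp add: norm_scale mult_right_mono)
      finally show ?thesis
        by (simp add: sum_distrib_right sum_distrib_left ac_simps)
    qed
  qed
  moreover have "h w \<noteq> 0"
    using lam_h[of w 1] \<phi>(2) lam.zero by auto
  ultimately show ?thesis by (rule that)
qed

end

section \<open>Finite rank operators\<close>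

definition blinfun_scale ::
    "('k \<Rightarrow> 'x::real_normed_vector \<Rightarrow> 'x) \<Rightarrow> 'k \<Rightarrow> ('x \<Rightarrow>\<^sub>L 'x) \<Rightarrow> ('x \<Rightarrow>\<^sub>L 'x)" where
  "blinfun_scale sc c T = Blinfun (\<lambda>x. sc c (blinfun_apply T x))"

definition rank_one ::
    "('k \<Rightarrow> 'x::real_normed_vector \<Rightarrow> 'x) \<Rightarrow> 'x \<Rightarrow> ('x \<Rightarrow> 'k) \<Rightarrow> ('x \<Rightarrow>\<^sub>L 'x)" where
  "rank_one sc x f = Blinfun (\<lambda>y. sc (f y) x)"

context normed_space_over
begin

lemma blinfun_scale_apply [simp]: "blinfun_apply (blinfun_scale sc c T) x = sc c (blinfun_apply T x)"
  unfolding blinfun_scale_def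
  by (subst bounded_linear_Blinfun_apply)
    (intro bounded_linear_compose[OF bounded_linear_scale] blinfun.bounded_linear_right, rule refl)

lemma rank_one_apply:
  assumes "f \<in> bounded_functionals sc"
  shows "blinfun_apply (rank_one sc x f) y = sc (f y) x"
  unfolding rank_one_def
  by (subst bounded_linear_Blinfun_apply)
    (intro bounded_linear_compose[OF bounded_linear_scale_left] functional_bounded_linear assms, rule refl)

lemma norm_blinfun_scale: "norm (blinfun_scale sc c T) = norm c * norm T"
proof -
  have le: "norm (blinfun_scale sc c T) \<le> norm c * norm T" for c T
    by (rule norm_blinfun_bound)
      (auto simp: norm_scale mult.assoc intro!: mult_left_mono norm_blinfun)
  show ?thesis
  proof (cases "c = 0")
    case True
    with le[of c T] show ?thesis by simp
  next
    case False
    have "T = blinfun_scale sc (inverse c) (blinfun_scale sc c T)"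
      using False by (intro blinfun_eqI) simp
    then have "norm T \<le> norm (inverse c) * norm (blinfun_scale sc c T)"
      using le[of "inverse c" "blinfun_scale sc c T"] by simp
    then have "norm c * norm T \<le> norm (blinfun_scale sc c T)"
      using False by (simp add: norm_divide field_simps)
    with le[of c T] show ?thesis by (rule antisym)
  qed
qed

lemma bounded_operatorsD:
  "T \<in> bounded_operators sc \<Longrightarrow> blinfun_apply T (sc c x) = sc c (blinfun_apply T x)"
  by (simp add: bounded_operators_def)

lemma zero_bounded_operators: "0 \<in> bounded_operators sc"
  and add_bounded_operators:
    "S \<in> bounded_operators sc \<Longrightarrow> T \<in> bounded_operators sc \<Longrightarrow> S + T \<in> bounded_operators sc"
  and scale_bounded_operators:
    "T \<in> bounded_operators sc \<Longrightarrow> blinfun_scale sc c T \<in> bounded_operators sc"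
  and compose_bounded_operators:
    "S \<in> bounded_operators sc \<Longrightarrow> T \<in> bounded_operators sc \<Longrightarrow> S o\<^sub>L T \<in> bounded_operators sc"
  by (auto simp: bounded_operators_def blinfun.add_left scale_right_distrib mult.commute)

lemma compact_operatorsI:
  assumes "T \<in> bounded_operators sc" "compact K" "blinfun_apply T ` cball 0 1 \<subseteq> K"
  shows "T \<in> compact_operators sc"
proof -
  have "K \<inter> closure (blinfun_apply T ` cball 0 1) = closure (blinfun_apply T ` cball 0 1)"
    using closure_minimal[OF assms(3) compact_imp_closed[OF assms(2)]] by blast
  with compact_Int_closed[OF assms(2) closed_closure, of "blinfun_apply T ` cball 0 1"] assms(1)
  show ?thesis by (simp add: compact_operators_def)
qed

lemma compact_operatorsD:
  assumes "T \<in> compact_operators sc"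
  shows "T \<in> bounded_operators sc"
    and "\<exists>K. compact K \<and> blinfun_apply T ` cball 0 1 \<subseteq> K"
  using assms closure_subset[of "blinfun_apply T ` cball 0 1"]
  unfolding compact_operators_def by blast+

lemma zero_compact_operators: "0 \<in> compact_operators sc"
  by (rule compact_operatorsI[OF zero_bounded_operators, of "{0}"]) auto

lemma add_compact_operators:
  assumes "S \<in> compact_operators sc" "T \<in> compact_operators sc"
  shows "S + T \<in> compact_operators sc"
proof -
  obtain K where K: "compact K" "blinfun_apply S ` cball 0 1 \<subseteq> K"
    using compact_operatorsD(2)[OF assms(1)] by blast
  obtain L where L: "compact L" "blinfun_apply T ` cball 0 1 \<subseteq> L"
    using compact_operatorsD(2)[OF assms(2)] by blast
  show ?thesis
  proof (rule compact_operatorsI)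
    show "S + T \<in> bounded_operators sc"
      using assms by (intro add_bounded_operators compact_operatorsD(1))
    show "compact {x + y | x y. x \<in> K \<and> y \<in> L}"
      by (rule compact_sums[OF K(1) L(1)])
    show "blinfun_apply (S + T) ` cball 0 1 \<subseteq> {x + y | x y. x \<in> K \<and> y \<in> L}"
      using K(2) L(2) unfolding blinfun.add_left by fast
  qed
qed

lemma compose_compact_operators_left:
  assumes "S \<in> bounded_operators sc" "T \<in> compact_operators sc"
  shows "S o\<^sub>L T \<in> compact_operators sc"
proof -
  obtain K where K: "compact K" "blinfun_apply T ` cball 0 1 \<subseteq> K"
    using compact_operatorsD(2)[OF assms(2)] by blast
  show ?thesis
  proof (rule compact_operatorsI)
    show "S o\<^sub>L T \<in> bounded_operators sc"
      by (intro compose_bounded_operators compact_operatorsD(1) assms)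
    show "compact (blinfun_apply S ` K)"
      by (intro compact_continuous_image K(1) blinfun.continuous_on continuous_intros)
    show "blinfun_apply (S o\<^sub>L T) ` cball 0 1 \<subseteq> blinfun_apply S ` K"
      using K(2) by auto
  qed
qed

lemma id_bounded_operators: "id_blinfun \<in> bounded_operators sc"
  by (simp add: bounded_operators_def)

lemma scale_compact_operators:
  assumes "T \<in> compact_operators sc"
  shows "blinfun_scale sc c T \<in> compact_operators sc"
proof -
  have "blinfun_scale sc c T = blinfun_scale sc c id_blinfun o\<^sub>L T"
    by (rule blinfun_eqI) simp
  then show ?thesis
    using compose_compact_operators_left[OF scale_bounded_operators[OF id_bounded_operators] assms]
    by simp
qed

lemma rank_one_bounded_operators:
  assumes "f \<in> bounded_functionals sc"
  shows "rank_one sc x f \<in> bounded_operators sc"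
  using assms by (simp add: bounded_operators_def rank_one_apply functional_scale)

text \<open>A bounded functional maps the unit ball into a closed ball of \<open>'k\<close>, which
  is compact.\<close>

lemma rank_one_compact_operators:
  assumes f: "f \<in> bounded_functionals sc"
  shows "rank_one sc x f \<in> compact_operators sc"
proof -
  obtain C where C: "\<And>y. norm (f y) \<le> norm y * C" "C > 0"
    using bounded_linear.pos_bounded[OF functional_bounded_linear[OF f]] by blast
  show ?thesis
  proof (rule compact_operatorsI)
    show "compact ((\<lambda>c. sc c x) ` cball 0 C)"
      by (intro compact_continuous_image linear_continuous_on bounded_linear_scale_left) simp
    have "norm (f y) \<le> C" if "norm y \<le> 1" for y
      using C(1)[of y] mult_right_mono[OF that, of C] C(2) by linarith
    then show "blinfun_apply (rank_one sc x f) ` cball 0 1 \<subseteq> (\<lambda>c. sc c x) ` cball 0 C"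
      by (auto simp: rank_one_apply[OF f])
  qed (rule rank_one_bounded_operators[OF f])
qed

text \<open>A list and not a set of pairs: \<open>rank_one_sum_zero_imp\<close> modifies the
  functionals, after which pairs may coincide and must still be counted separately.\<close>

definition rank_one_sum :: "('x \<times> ('x \<Rightarrow> 'k)) list \<Rightarrow> 'x \<Rightarrow>\<^sub>L 'x" where
  "rank_one_sum ps = (\<Sum>(x, f)\<leftarrow>ps. rank_one sc x f)"

text \<open>Induction on a spanning set of the range. If \<open>v\<close> lies outside
  \<open>span S\<close>, the coefficient of \<open>T y\<close> along \<open>v\<close> is unique,
  therefore linear in \<open>y\<close>, and bounded by \<open>scale_gap\<close>. Subtracting the
  corresponding rank one operator leaves a range inside \<open>span S\<close>.\<close>

lemma finite_rank_operator_decomposition: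
  assumes T: "T \<in> finite_rank_operators sc"
  obtains ps where "set ps \<subseteq> UNIV \<times> bounded_functionals sc" "T = rank_one_sum ps"
proof -
  have "\<exists>ps. set ps \<subseteq> UNIV \<times> bounded_functionals sc \<and> T = rank_one_sum ps"
    if "finite S" "T \<in> bounded_operators sc" "range (blinfun_apply T) \<subseteq> span S" for S T
    using that
  proof (induction S arbitrary: T)
    case empty
    then have "T = 0" by (intro blinfun_eqI) auto
    then show ?case by (intro exI[of _ "[]"]) (simp add: rank_one_sum_def)
  next
    case (insert v S)
    show ?case
    proof (cases "v \<in> span S")
      case True
      then show ?thesis
        using insert by (metis span_redundant)
    next
      case False
      obtain d where d: "0 < d" "\<And>c m. m \<in> span S \<Longrightarrow> norm c * d \<le> norm (m + sc c v)"
        using scale_gap[OF closed_span_finite[OF insert.hyps(1)] subspace_span False] by blast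
      have "\<exists>c. blinfun_apply T y - sc c v \<in> span S" for y
        using insert.prems(2) span_insert[of v S] by auto
      then obtain f where f: "\<And>y. blinfun_apply T y - sc (f y) v \<in> span S"
        by metis
      have uniq: "c = c'" if "sc c v - sc c' v \<in> span S" for c c'
      proof -
        have "norm (c - c') * d \<le> norm (- (sc c v - sc c' v) + sc (c - c') v)"
          using that by (intro d(2) span_neg)
        then show ?thesis
          using d(1) by (simp add: scale_left_diff_distrib mult_le_0_iff)
      qed
      have fB: "f \<in> bounded_functionals sc"
      proof (rule bounded_functionalsI)
        fix x y c
        show "f (x + y) = f x + f y"
        proof (rule uniq)
          have "(blinfun_apply T x - sc (f x) v) + (blinfun_apply T y - sc (f y) v)
              - (blinfun_apply T (x + y) - sc (f (x + y)) v) \<in> span S"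
            by (intro span_diff span_add f)
          then show "sc (f (x + y)) v - sc (f x + f y) v \<in> span S"
            by (simp add: blinfun.add_right scale_left_distrib algebra_simps)
        qed
        show "f (sc c x) = c * f x"
        proof (rule uniq)
          have "sc c (blinfun_apply T x - sc (f x) v)
              - (blinfun_apply T (sc c x) - sc (f (sc c x)) v) \<in> span S"
            by (intro span_diff span_scale f)
          then show "sc (f (sc c x)) v - sc (c * f x) v \<in> span S"
            by (simp add: bounded_operatorsD[OF insert.prems(1)] scale_right_diff_distrib)
        qed
        have "norm (f x) * d \<le> norm (blinfun_apply T x)"
          using d(2)[OF f, of "f x" x] by simp
        also have "\<dots> \<le> norm T * norm x"
          by (rule norm_blinfun)
        finally show "norm (f x) \<le> (norm T / d) * norm x"
          using d(1) by (simp add: field_simps)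
      qed
      let ?T' = "T + blinfun_scale sc (- 1) (rank_one sc v f)"
      have "\<exists>ps. set ps \<subseteq> UNIV \<times> bounded_functionals sc \<and> ?T' = rank_one_sum ps"
      proof (rule insert.IH)
        show "?T' \<in> bounded_operators sc"
          by (intro add_bounded_operators scale_bounded_operators rank_one_bounded_operators fB
              insert.prems(1))
        show "range (blinfun_apply ?T') \<subseteq> span S"
          using f by (auto simp: blinfun.add_left rank_one_apply[OF fB])
      qed
      then obtain ps where ps: "set ps \<subseteq> UNIV \<times> bounded_functionals sc" "?T' = rank_one_sum ps"
        by blast
      have "T = rank_one sc v f + ?T'"
        by (rule blinfun_eqI) (simp add: blinfun.add_left)
      then show ?thesis
        using ps fB by (intro exI[of _ "(v, f) # ps"]) (simp add: rank_one_sum_def)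
    qed
  qed
  then show ?thesis
    using T that unfolding finite_rank_operators_def by blast
qed

lemma rank_one_finite_rank_operators:
  assumes "f \<in> bounded_functionals sc"
  shows "rank_one sc x f \<in> finite_rank_operators sc"
proof -
  have "range (blinfun_apply (rank_one sc x f)) \<subseteq> span {x}"
    using assms by (auto simp: rank_one_apply intro: span_scale span_base)
  then show ?thesis
    using rank_one_bounded_operators[OF assms] unfolding finite_rank_operators_def
    by (blast intro: finite.intros)
qed

lemma
  shows zero_finite_rank_operators: "0 \<in> finite_rank_operators sc"
    and add_finite_rank_operators: "S \<in> finite_rank_operators sc \<Longrightarrow> T \<in> finite_rank_operators sc
      \<Longrightarrow> S + T \<in> finite_rank_operators sc"
    and compose_finite_rank_operators_left: "R \<in> bounded_operators sc \<Longrightarrow> T \<in> finite_rank_operators sc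
      \<Longrightarrow> R o\<^sub>L T \<in> finite_rank_operators sc"
proof -
  show "0 \<in> finite_rank_operators sc"
    unfolding finite_rank_operators_def
    by (auto intro!: zero_bounded_operators exI[of _ "{}"])
  show "S + T \<in> finite_rank_operators sc"
    if ST: "S \<in> finite_rank_operators sc" "T \<in> finite_rank_operators sc"
  proof -
    obtain A B where A: "finite A" "range (blinfun_apply S) \<subseteq> span A"
      and B: "finite B" "range (blinfun_apply T) \<subseteq> span B"
      using ST by (auto simp: finite_rank_operators_def)
    have "blinfun_apply (S + T) x \<in> span (A \<union> B)" for x
      unfolding blinfun.add_left
      using A(2) B(2) span_mono[of A "A \<union> B"] span_mono[of B "A \<union> B"]
      by (intro span_add) auto
    then show ?thesis
      using ST A(1) B(1) by (auto simp: finite_rank_operators_def add_bounded_operators intro!: exI[of _ "A \<union> B"])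
  qed
  show "R o\<^sub>L T \<in> finite_rank_operators sc"
    if R: "R \<in> bounded_operators sc" and T: "T \<in> finite_rank_operators sc"
  proof -
    obtain A where A: "finite A" "range (blinfun_apply T) \<subseteq> span A"
      using T by (auto simp: finite_rank_operators_def)
    interpret R: Vector_Spaces.linear sc sc "blinfun_apply R"
      by unfold_locales (simp_all add: blinfun.add_right bounded_operatorsD[OF R])
    have "blinfun_apply R y \<in> span (blinfun_apply R ` A)" if "y \<in> span A" for y
      using that R.span_image[of A] by blast
    then show ?thesis
      using R T A by (auto simp: finite_rank_operators_def compose_bounded_operators
          intro!: exI[of _ "blinfun_apply R ` A"])
  qed
qed

lemma scale_finite_rank_operators:
  assumes "T \<in> finite_rank_operators sc"
  shows "blinfun_scale sc c T \<in> finite_rank_operators sc"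
proof -
  have "blinfun_scale sc c T = blinfun_scale sc c id_blinfun o\<^sub>L T"
    by (rule blinfun_eqI) simp
  then show ?thesis
    using compose_finite_rank_operators_left[OF scale_bounded_operators[OF id_bounded_operators] assms]
    by simp
qed

lemma rank_one_sum_Nil [simp]: "rank_one_sum [] = 0"
  and rank_one_sum_Cons [simp]: "rank_one_sum ((x, f) # ps) = rank_one sc x f + rank_one_sum ps"
  and rank_one_sum_append: "rank_one_sum (ps @ qs) = rank_one_sum ps + rank_one_sum qs"
  by (simp_all add: rank_one_sum_def)

lemma finite_rank_compact_operators: "finite_rank_operators sc \<subseteq> compact_operators sc"
proof
  fix T assume "T \<in> finite_rank_operators sc"
  then obtain ps where ps: "set ps \<subseteq> UNIV \<times> bounded_functionals sc" "T = rank_one_sum ps"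
    by (rule finite_rank_operator_decomposition)
  have "rank_one_sum ps \<in> compact_operators sc" using ps(1)
    by (induction ps)
      (auto intro!: zero_compact_operators add_compact_operators rank_one_compact_operators)
  with ps(2) show "T \<in> compact_operators sc" by simp
qed

end

section \<open>Antisymmetric forms on the finite rank operators\<close>

context normed_space_over
begin

lemma rank_one_sum_apply:
  assumes "set ps \<subseteq> UNIV \<times> bounded_functionals sc"
  shows "blinfun_apply (rank_one_sum ps) y = (\<Sum>(x, f)\<leftarrow>ps. sc (f y) x)"
  using assms by (induction ps) (auto simp: blinfun.add_left rank_one_apply)

lemma functional_mult:
  assumes "f \<in> bounded_functionals sc"
  shows "(\<lambda>y. c * f y) \<in> bounded_functionals sc"
proof -
  obtain K where K: "\<And>x. norm (f x) \<le> norm x * K"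
    using bounded_linear.bounded[OF functional_bounded_linear[OF assms]] by blast
  have "norm c * norm (f x) \<le> norm c * K * norm x" for x
    using mult_left_mono[OF K[of x] norm_ge_zero[of c]] by (simp add: ac_simps)
  then show ?thesis
    using functional_add[OF assms] functional_scale[OF assms]
    by (intro bounded_functionalsI[where C = "norm c * K"]) (simp_all add: norm_mult algebra_simps)
qed

lemma functional_plus:
  assumes "f \<in> bounded_functionals sc" "g \<in> bounded_functionals sc"
  shows "(\<lambda>y. f y + g y) \<in> bounded_functionals sc"
proof -
  obtain K L where K: "\<And>x. norm (f x) \<le> norm x * K" and L: "\<And>x. norm (g x) \<le> norm x * L"
    using bounded_linear.bounded[OF functional_bounded_linear[OF assms(1)]]
      bounded_linear.bounded[OF functional_bounded_linear[OF assms(2)]] by blast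
  have "norm (f x + g x) \<le> (K + L) * norm x" for x
    using norm_triangle_le[of "f x" "g x" "(K + L) * norm x"] K[of x] L[of x]
    by (simp add: algebra_simps)
  then show ?thesis
    using functional_add[OF assms(1)] functional_scale[OF assms(1)]
      functional_add[OF assms(2)] functional_scale[OF assms(2)]
    by (intro bounded_functionalsI[where C = "K + L"]) (simp_all add: algebra_simps)
qed

text \<open>
  Finite rank operators form the tensor product of the space and its dual: a form that is bilinear
  in \<open>(x, f)\<close> factors through \<^term>\<open>rank_one sc x f\<close>.
\<close>

lemma rank_one_sum_zero_imp:
  fixes \<theta> :: "'x \<Rightarrow> ('x \<Rightarrow> 'k) \<Rightarrow> 'k"
  assumes add1: "\<And>x y f. f \<in> bounded_functionals sc \<Longrightarrow> \<theta> (x + y) f = \<theta> x f + \<theta> y f"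
    and scale1: "\<And>c x f. f \<in> bounded_functionals sc \<Longrightarrow> \<theta> (sc c x) f = c * \<theta> x f"
    and add2: "\<And>x f g. f \<in> bounded_functionals sc \<Longrightarrow> g \<in> bounded_functionals sc
      \<Longrightarrow> \<theta> x (\<lambda>y. f y + g y) = \<theta> x f + \<theta> x g"
    and scale2: "\<And>c x f. f \<in> bounded_functionals sc \<Longrightarrow> \<theta> x (\<lambda>y. c * f y) = c * \<theta> x f"
    and ps: "set ps \<subseteq> UNIV \<times> bounded_functionals sc" "rank_one_sum ps = 0"
  shows "(\<Sum>(x, f)\<leftarrow>ps. \<theta> x f) = 0"
  using ps
proof (induction ps rule: length_induct)
  case (1 ps)
  show ?case
  proof (cases ps)
    case Nil
    then show ?thesis by simp
  next
    case (Cons p qs)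
    obtain x f where p: "p = (x, f)" by fastforce
    from Cons p "1.prems" have f: "f \<in> bounded_functionals sc"
      and qs: "set qs \<subseteq> UNIV \<times> bounded_functionals sc" by auto
    have sum0: "sc (f y) x + (\<Sum>(z, g)\<leftarrow>qs. sc (g y) z) = 0" for y
      using rank_one_sum_apply[OF "1.prems"(1), of y] "1.prems"(2) Cons p by simp
    show ?thesis
    proof (cases "\<exists>y. f y \<noteq> 0")
      case False
      then have "f = (\<lambda>y. 0 * f y)" by auto
      then have "\<theta> x f = 0"
        using scale2[OF f, of x 0] by simp
      moreover have "rank_one sc x f = 0"
        using False by (intro blinfun_eqI) (simp add: rank_one_apply[OF f])
      then have "(\<Sum>(x, f)\<leftarrow>qs. \<theta> x f) = 0"
        using "1.IH" "1.prems" qs Cons p by simp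
      ultimately show ?thesis using Cons p by simp
    next
      case True
      then obtain y where y: "f y \<noteq> 0" by blast
      \<comment> \<open>Evaluated at \<open>y\<close>, the relation says \<open>x = - w\<close>.
        Replacing each remaining \<open>g\<close> by \<open>g - c g f\<close> therefore absorbs the
        first pair: the shorter list still sums to 0, and the form changes by exactly the term of
        the removed pair.\<close>
      define c where "c g = g y / f y" for g
      define g' where "g' g = (\<lambda>u. g u + (- c g) * f u)" for g
      define w where "w = (\<Sum>(z, g)\<leftarrow>qs. sc (c g) z)"
      define qs' where "qs' = map (\<lambda>(z, g). (z, g' g)) qs"
      have g': "g' g \<in> bounded_functionals sc" if "g \<in> bounded_functionals sc" for g
        unfolding g'_def by (intro functional_plus functional_mult that f)
      have \<theta>_g': "\<theta> z (g' g) = \<theta> z g - c g * \<theta> z f" if "g \<in> bounded_functionals sc" for z g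
        unfolding g'_def add2[OF that functional_mult[OF f]] scale2[OF f] by simp
      have zero: "\<theta> 0 f = 0"
        using scale1[OF f, of 0 0] by simp
      have qs'_B: "set qs' \<subseteq> UNIV \<times> bounded_functionals sc"
        using qs g' by (auto simp: qs'_def)
      have "sc (f y) w = (\<Sum>(z, g)\<leftarrow>qs. sc (g y) z)"
        unfolding w_def c_def using y
        by (induction qs) (auto simp: scale_right_distrib)
      then have "sc (f y) (x + w) = 0"
        using sum0[of y] by (simp add: scale_right_distrib)
      then have xw: "x = - w"
        using y by (simp add: eq_neg_iff_add_eq_0)
      have "(\<Sum>(z, g)\<leftarrow>qs'. sc (g u) z) = (\<Sum>(z, g)\<leftarrow>qs. sc (g u) z) - sc (f u) w" for u
        unfolding w_def qs'_def g'_def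
        by (induction qs) (auto simp: scale_right_distrib scale_left_diff_distrib scale_left_distrib mult.commute)
      then have "rank_one_sum qs' = 0"
        using sum0 xw by (intro blinfun_eqI) (simp add: rank_one_sum_apply[OF qs'_B])
      then have "(\<Sum>(z, g)\<leftarrow>qs'. \<theta> z g) = 0"
        using "1.IH"[rule_format, OF _ qs'_B] Cons by (simp add: qs'_def)
      moreover have "(\<Sum>(z, g)\<leftarrow>qs'. \<theta> z g) = (\<Sum>(z, g)\<leftarrow>qs. \<theta> z g) - \<theta> w f"
        unfolding w_def qs'_def using qs
        by (induction qs) (auto simp: zero add1[OF f] scale1[OF f] \<theta>_g')
      moreover have "\<theta> x f = - \<theta> w f"
        using scale1[OF f, of "- 1" w] xw by simp
      ultimately show ?thesis using Cons p by simp
    qed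
  qed
qed

text \<open>In the application \<open>\<beta> a b\<close> is the value at \<open>a \<circ> b\<close>
  of a functional that vanishes on \<open>T_Lie\<close>; \<open>antisym\<close> and
  \<open>jordan\<close> are then the two relations modulo \<open>T_Lie\<close>.\<close>

context
  fixes \<beta> :: "('x \<Rightarrow>\<^sub>L 'x) \<Rightarrow> ('x \<Rightarrow>\<^sub>L 'x) \<Rightarrow> 'k"
  assumes add_left: "\<And>a a' b. a \<in> finite_rank_operators sc \<Longrightarrow> a' \<in> finite_rank_operators sc
      \<Longrightarrow> b \<in> finite_rank_operators sc \<Longrightarrow> \<beta> (a + a') b = \<beta> a b + \<beta> a' b"
    and scale_left: "\<And>c a b. a \<in> finite_rank_operators sc \<Longrightarrow> b \<in> finite_rank_operators sc
      \<Longrightarrow> \<beta> (blinfun_scale sc c a) b = c * \<beta> a b"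
    and antisym: "\<And>a b. a \<in> finite_rank_operators sc \<Longrightarrow> b \<in> finite_rank_operators sc
      \<Longrightarrow> \<beta> a b = - \<beta> b a"
    and jordan: "\<And>a b c. a \<in> finite_rank_operators sc \<Longrightarrow> b \<in> finite_rank_operators sc
      \<Longrightarrow> c \<in> finite_rank_operators sc \<Longrightarrow>
      \<beta> ((a o\<^sub>L b) + (b o\<^sub>L a)) c + \<beta> ((a o\<^sub>L c) + (c o\<^sub>L a)) b + \<beta> ((b o\<^sub>L c) + (c o\<^sub>L b)) a = 0"
begin

abbreviation "FR \<equiv> finite_rank_operators sc"
abbreviation "D \<equiv> bounded_functionals sc"
abbreviation "E \<equiv> rank_one sc"

lemma scale_right: "a \<in> FR \<Longrightarrow> b \<in> FR \<Longrightarrow> \<beta> a (blinfun_scale sc c b) = c * \<beta> a b"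
  using antisym[of a "blinfun_scale sc c b"] antisym[of a b] scale_left[of b a c]
    scale_finite_rank_operators[of b c] by simp

lemma add_right: "a \<in> FR \<Longrightarrow> b \<in> FR \<Longrightarrow> b' \<in> FR \<Longrightarrow> \<beta> a (b + b') = \<beta> a b + \<beta> a b'"
  using antisym[of a "b + b'"] antisym[of a b] antisym[of a b'] add_left[of b b' a]
    add_finite_rank_operators[of b b'] by simp

lemma beta_self: "a \<in> FR \<Longrightarrow> \<beta> a a = 0"
  using antisym[of a a] by simp

section \<open>Algebra of rank one operators\<close>

lemma rank_one_compose: "f \<in> D \<Longrightarrow> g \<in> D \<Longrightarrow> E x f o\<^sub>L E y g = blinfun_scale sc (f y) (E x g)"
  by (rule blinfun_eqI) (simp add: rank_one_apply functional_scale mult.commute)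

lemma rank_one_scale: "f \<in> D \<Longrightarrow> E (sc c x) f = blinfun_scale sc c (E x f)"
  by (rule blinfun_eqI) (simp add: rank_one_apply mult.commute)

lemma rank_one_scale_functional: "f \<in> D \<Longrightarrow> E x (\<lambda>y. c * f y) = blinfun_scale sc c (E x f)"
  by (rule blinfun_eqI) (simp add: rank_one_apply functional_mult)

lemma rank_one_add: "f \<in> D \<Longrightarrow> E (x + y) f = E x f + E y f"
  by (rule blinfun_eqI) (simp add: rank_one_apply blinfun.add_left scale_right_distrib)

lemma rank_one_add_functional: "f \<in> D \<Longrightarrow> g \<in> D \<Longrightarrow> E x (\<lambda>y. f y + g y) = E x f + E x g"
  by (rule blinfun_eqI) (simp add: rank_one_apply functional_plus blinfun.add_left scale_left_distrib)

lemmas rank_one_FR = rank_one_finite_rank_operators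

text \<open>Since \<open>f0 x0 = 1\<close>, the operator \<open>E x0 f0\<close> is idempotent. It
  serves as the reference matrix unit from which all values of the form are computed.\<close>

context
  fixes x0 f0
  assumes f0: "f0 \<in> D" and f0_x0: "f0 x0 = 1"
begin

text \<open>The commutator of \<open>E x f0\<close> and \<open>E x0 f\<close> is
  \<open>E x f\<close> minus \<open>f x\<close> times \<open>E x0 f0\<close>. If \<beta> a b =
  \<tau> [a, b] for a linear functional \<tau>, then \<tau> may be changed by a multiple of the
  trace, so it can be normalised to vanish at \<open>E x0 f0\<close>; its value at
  \<open>E x f\<close> is then forced to be \<open>\<theta> x f\<close>.\<close>

definition \<theta> :: "'x \<Rightarrow> ('x \<Rightarrow> 'k) \<Rightarrow> 'k" where
  "\<theta> x f = \<beta> (E x f0) (E x0 f)"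

text \<open>
  The commutator of \<open>rank_one sc x f\<close> and \<open>rank_one sc y g\<close> is
  \<open>f y \<cdot> rank_one sc x g - g x \<cdot> rank_one sc y f\<close>, so \<open>\<delta>\<close> is the deviation of \<open>\<beta>\<close> from the form
  that \<open>\<theta>\<close> induces through commutators.
\<close>

definition \<delta> :: "'x \<Rightarrow> ('x \<Rightarrow> 'k) \<Rightarrow> 'x \<Rightarrow> ('x \<Rightarrow> 'k) \<Rightarrow> 'k" where
  "\<delta> x f y g = \<beta> (E x f) (E y g) - f y * \<theta> x g + g x * \<theta> y f"

lemma delta_antisym: "f \<in> D \<Longrightarrow> g \<in> D \<Longrightarrow> \<delta> x f y g = - \<delta> y g x f"
  using antisym[OF rank_one_FR rank_one_FR, of f g x y] by (simp add: \<delta>_def)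

text \<open>The definition of \<open>\<theta>\<close> cancels the first two terms of
  \<open>\<delta>\<close>; the third contains \<open>\<theta> x0 f0\<close>, the value of
  \<open>\<beta>\<close> at two equal arguments.\<close>

lemma delta_axis: "f \<in> D \<Longrightarrow> \<delta> x f0 x0 f = 0"
  using beta_self[OF rank_one_FR[OF f0], of x0] by (simp add: \<delta>_def \<theta>_def f0_x0)

lemma delta_axis': "f \<in> D \<Longrightarrow> \<delta> x0 f x f0 = 0"
  using delta_antisym[OF _ f0, of f x0 x] delta_axis[of f x] by simp

lemma beta_jordan_rank_one:
  assumes "f \<in> D" "g \<in> D" "h \<in> D"
  shows "\<beta> ((E x f o\<^sub>L E y g) + (E y g o\<^sub>L E x f)) (E z h)
    = f y * \<beta> (E x g) (E z h) + g x * \<beta> (E y f) (E z h)"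
  using assms by (simp add: rank_one_compose add_left scale_left rank_one_FR scale_finite_rank_operators)

text \<open>The identity passes from \<open>\<beta>\<close> to the deviation because every form
  \<tau> [a, b] satisfies it too: the twelve products in [ab + ba, c] + [ac + ca, b] + [bc + cb, a]
  cancel in pairs.\<close>

lemma delta_jordan:
  assumes "f \<in> D" "g \<in> D" "h \<in> D"
  shows "f y * \<delta> x g z h + g x * \<delta> y f z h + f z * \<delta> x h y g + h x * \<delta> z f y g
    + g z * \<delta> y h x f + h y * \<delta> z g x f = 0"
proof -
  have "f y * \<beta> (E x g) (E z h) + g x * \<beta> (E y f) (E z h)
      + (f z * \<beta> (E x h) (E y g) + h x * \<beta> (E z f) (E y g))
      + (g z * \<beta> (E y h) (E x f) + h y * \<beta> (E z g) (E x f)) = 0"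
    using jordan[OF rank_one_FR rank_one_FR rank_one_FR, OF assms, of x y z]
    by (simp only: beta_jordan_rank_one assms)
  then show ?thesis
    unfolding \<delta>_def by (simp add: algebra_simps)
qed

text \<open>With \<open>E x0 f0\<close> in two of the three places the wanted value occurs twice,
  and all other terms lie on the axes where \<open>\<delta>\<close> vanishes.\<close>

lemma delta_zero_left: assumes "g \<in> D" shows "\<delta> x0 f0 y g = 0"
proof -
  have "2 * \<delta> x0 f0 y g = 0"
    using delta_jordan[OF f0 f0 assms, where x = x0 and y = x0 and z = y] f0_x0
    by (simp add: delta_axis delta_axis' assms f0)
  then show ?thesis by simp
qed

lemma delta_zero_right: "g \<in> D \<Longrightarrow> \<delta> y g x0 f0 = 0"
  using delta_antisym[OF _ f0, of g y x0] delta_zero_left[of g y] by simp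

text \<open>The identity for \<open>E x0 f0\<close>, \<open>E x g\<close>, \<open>E x0 f\<close> has
  only two terms that are not already known to vanish. The gain is that \<open>x\<close> is left
  only in the scalar \<open>f0 x\<close>.\<close>

lemma delta_row: assumes "f \<in> D" "g \<in> D" shows "\<delta> x g x0 f = f0 x * \<delta> x0 g x0 f"
proof -
  have "f0 x * \<delta> x0 g x0 f + \<delta> x0 f x g = 0"
    using delta_jordan[OF f0 assms(2,1), where x = x0 and y = x and z = x0] assms
    by (simp add: delta_axis delta_axis' delta_zero_left delta_zero_right f0 f0_x0)
  then show ?thesis
    using delta_antisym[OF assms(2,1), of x x0] by (simp add: add_eq_0_iff)
qed

text \<open>The counterpart of \<open>delta_row\<close> with vectors and functionals exchanged, from
  the identity for \<open>E x0 f0\<close>, \<open>E y f\<close>, \<open>E x f0\<close>.\<close>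

lemma delta_column: assumes "f \<in> D" shows "\<delta> y f x f0 = f x0 * \<delta> y f0 x f0"
proof -
  have "f x0 * \<delta> y f0 x f0 + \<delta> x f0 y f = 0"
    using delta_jordan[OF f0 assms f0, where x = x0 and y = y and z = x] assms
    by (simp add: delta_axis delta_axis' delta_zero_left delta_zero_right f0 f0_x0)
  then show ?thesis
    using delta_antisym[OF assms f0, of y x] by (simp add: add_eq_0_iff)
qed

lemma delta_self: "f \<in> D \<Longrightarrow> \<delta> x f x f = 0"
  using delta_antisym[of f f x x] by simp

text \<open>If \<open>f\<close> is not a multiple of \<open>f0\<close>, some \<open>z\<close> has
  \<open>f z \<noteq> f x0 * f0 z\<close>, and the identity for \<open>E x0 f\<close>,
  \<open>E z f\<close>, \<open>E x0 g\<close> reduces to this nonzero difference times the wanted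
  value. If \<open>f\<close> is a multiple of \<open>f0\<close>, homogeneity leads back to
  \<open>delta_zero_left\<close>.\<close>

lemma delta_row_zero: assumes f: "f \<in> D" and g: "g \<in> D" shows "\<delta> x0 f x0 g = 0"
proof (cases "\<exists>z. f z \<noteq> f x0 * f0 z")
  case True
  then obtain z where z: "f z \<noteq> f x0 * f0 z" by blast
  have "\<delta> x0 f z f = 0"
    using delta_antisym[OF f f, of x0 z] delta_row[OF f f, of z] delta_self[OF f, of x0] by simp
  moreover have "\<delta> z g x0 f = - (f0 z * \<delta> x0 f x0 g)"
    using delta_row[OF f g, of z] delta_antisym[OF g f, of x0 x0] by simp
  moreover have "\<delta> z f x0 g + \<delta> x0 g z f = 0"
    using delta_antisym[OF f g, of z x0] by simp
  ultimately have "f z * \<delta> x0 f x0 g + f x0 * (- (f0 z * \<delta> x0 f x0 g)) = 0"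
    using delta_jordan[OF f f g, where x = x0 and y = z and z = x0] delta_self[OF f, of x0]
    by (simp add: add_eq_0_iff)
  then have "(f z - f x0 * f0 z) * \<delta> x0 f x0 g = 0"
    by (simp add: left_diff_distrib mult.assoc)
  with z show ?thesis by simp
next
  case False
  then have eq: "f = (\<lambda>z. f x0 * f0 z)" by blast
  have "\<delta> x0 (\<lambda>z. c * f0 z) x0 g = c * \<delta> x0 f0 x0 g" for c
    by (simp add: \<delta>_def \<theta>_def rank_one_scale_functional f0 scale_left scale_right rank_one_FR g algebra_simps)
  then show ?thesis
    using delta_zero_left[OF g, of x0] by (subst eq) simp
qed

text \<open>Dual to \<open>delta_row_zero\<close>, with multiplier
  \<open>h (y - sc (f0 y) x0)\<close>. That some bounded functional \<open>h\<close> makes it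
  nonzero is where the Hahn--Banach theorem enters; in the dual situation a functional that is not
  zero has a nonzero value by definition.\<close>

lemma delta_column_zero: "\<delta> y f0 x f0 = 0"
proof (cases "y = sc (f0 y) x0")
  case False
  then obtain h where h: "h \<in> D" "h (y - sc (f0 y) x0) \<noteq> 0"
    using functional_nonzero[of "y - sc (f0 y) x0"] by auto
  have "\<delta> y h y f0 = 0"
    using delta_column[OF h(1), of y y] delta_self[OF f0, of y] by simp
  then have "\<delta> y f0 y h = 0"
    using delta_antisym[OF f0 h(1), of y y] by simp
  moreover have "\<delta> x h y f0 = - (h x0 * \<delta> y f0 x f0)"
    using delta_column[OF h(1), of x y] delta_antisym[OF f0 f0, of x y] by simp
  moreover have "\<delta> y h x f0 + \<delta> x f0 y h = 0"
    using delta_antisym[OF f0 h(1), of x y] by simp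
  ultimately have "h y * \<delta> y f0 x f0 + f0 y * (- (h x0 * \<delta> y f0 x f0)) = 0"
    using delta_jordan[OF f0 h(1) f0, where x = y and y = y and z = x] delta_self[OF f0, of y]
    by (simp add: add_eq_0_iff)
  then have "(h y - f0 y * h x0) * \<delta> y f0 x f0 = 0"
    by (simp add: left_diff_distrib mult.assoc)
  moreover have "h (y - sc (f0 y) x0) = h y - f0 y * h x0"
    using functional_add[OF h(1), of "y - sc (f0 y) x0" "sc (f0 y) x0"] functional_scale[OF h(1)]
    by simp
  ultimately show ?thesis using h(2) by simp
next
  case True
  have "\<delta> (sc c x0) f0 x f0 = c * \<delta> x0 f0 x f0" for c
    by (simp add: \<delta>_def \<theta>_def rank_one_scale f0 scale_left scale_right rank_one_FR functional_scale algebra_simps)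
  then show ?thesis
    using delta_zero_left[OF f0, of x] by (subst True) simp
qed

text \<open>The product of \<open>E x f0\<close> and \<open>E x0 f\<close> is \<open>E x f\<close>.
  Hence the identity for \<open>E x f0\<close>, \<open>E x0 f\<close>, \<open>E y g\<close>
  expresses the general value of \<open>\<delta>\<close> through row and column terms, all of which
  vanish.\<close>

lemma delta_zero: assumes "f \<in> D" "g \<in> D" shows "\<delta> x f y g = 0"
proof -
  show ?thesis
    using delta_jordan[OF f0 assms, where x = x and y = x0 and z = y] delta_row[OF assms, of x]
      delta_column[OF assms(1), of y x]
    by (simp add: f0_x0 delta_zero_left delta_axis delta_axis' delta_row_zero delta_column_zero assms)
qed

lemma beta_rank_one: "f \<in> D \<Longrightarrow> g \<in> D \<Longrightarrow> \<beta> (E x f) (E y g) = f y * \<theta> x g - g x * \<theta> y f"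
  using delta_zero[of f g x y] by (simp add: \<delta>_def algebra_simps)

section \<open>Extension of \<theta> to all finite rank operators\<close>

lemma theta_add: "f \<in> D \<Longrightarrow> \<theta> (x + y) f = \<theta> x f + \<theta> y f"
  and theta_scale: "f \<in> D \<Longrightarrow> \<theta> (sc c x) f = c * \<theta> x f"
  and theta_add_functional:
    "f \<in> D \<Longrightarrow> g \<in> D \<Longrightarrow> \<theta> x (\<lambda>y. f y + g y) = \<theta> x f + \<theta> x g"
  and theta_scale_functional: "f \<in> D \<Longrightarrow> \<theta> x (\<lambda>y. c * f y) = c * \<theta> x f"
  by (simp_all add: \<theta>_def rank_one_add rank_one_scale rank_one_add_functional rank_one_scale_functional
      add_left add_right scale_left scale_right rank_one_FR f0)

text \<open>The graph of the linear extension of \<open>\<theta>\<close> from rank one operators. As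
  a relation it is additive by mere concatenation of lists; that the value does not depend on the
  decomposition enters only at the operator 0, in \<open>induced_zeroD\<close>.\<close>

definition induced :: "('x \<Rightarrow>\<^sub>L 'x) \<Rightarrow> 'k \<Rightarrow> bool" where
  "induced a t \<longleftrightarrow> (\<exists>ps. set ps \<subseteq> UNIV \<times> D \<and> a = rank_one_sum ps \<and> t = (\<Sum>(x, f)\<leftarrow>ps. \<theta> x f))"

lemma induced_zeroD: assumes "induced 0 t" shows "t = 0"
proof -
  obtain ps where ps: "set ps \<subseteq> UNIV \<times> D" "rank_one_sum ps = 0" "t = (\<Sum>(x, f)\<leftarrow>ps. \<theta> x f)"
    using assms unfolding induced_def by auto
  show ?thesis
    unfolding ps(3)
    by (rule rank_one_sum_zero_imp[OF theta_add theta_scale theta_add_functional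
          theta_scale_functional ps(1,2)])
qed

lemma induced_zero: "induced 0 0"
  unfolding induced_def by (intro exI[of _ "[]"]) simp

lemma induced_add: "induced a s \<Longrightarrow> induced b t \<Longrightarrow> induced (a + b) (s + t)"
  unfolding induced_def
proof (elim exE conjE)
  fix ps qs assume "set ps \<subseteq> UNIV \<times> D" "a = rank_one_sum ps" "s = (\<Sum>(x, f)\<leftarrow>ps. \<theta> x f)"
    "set qs \<subseteq> UNIV \<times> D" "b = rank_one_sum qs" "t = (\<Sum>(x, f)\<leftarrow>qs. \<theta> x f)"
  then show "\<exists>ps. set ps \<subseteq> UNIV \<times> D \<and> a + b = rank_one_sum ps \<and> s + t = (\<Sum>(x, f)\<leftarrow>ps. \<theta> x f)"
    by (intro exI[of _ "ps @ qs"]) (simp add: rank_one_sum_append)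
qed

lemma induced_rank_one:
  assumes f: "f \<in> D" and g: "g \<in> D"
  shows "induced ((E x f o\<^sub>L E y g) - (E y g o\<^sub>L E x f)) (\<beta> (E x f) (E y g))"
proof -
  have "(E x f o\<^sub>L E y g) - (E y g o\<^sub>L E x f) = rank_one_sum [(sc (f y) x, g), (sc (- g x) y, f)]"
    by (rule blinfun_eqI)
      (simp add: rank_one_apply functional_scale f g blinfun.add_left blinfun.diff_left mult.commute)
  moreover have "\<beta> (E x f) (E y g) = (\<Sum>(x, f)\<leftarrow>[(sc (f y) x, g), (sc (- g x) y, f)]. \<theta> x f)"
    by (simp add: beta_rank_one theta_scale f g del: scale_minus_left)
  ultimately show ?thesis
    unfolding induced_def using f g by (intro exI[of _ "[(sc (f y) x, g), (sc (- g x) y, f)]"]) simp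
qed

text \<open>Both the commutator and \<open>\<beta>\<close> are biadditive, so the rank one case
  extends along a list in the second argument and then along a list in the first.\<close>

lemma induced_commutator:
  assumes "a \<in> FR" "b \<in> FR"
  shows "induced ((a o\<^sub>L b) - (b o\<^sub>L a)) (\<beta> a b)"
proof -
  have sumF: "rank_one_sum ps \<in> FR" if "set ps \<subseteq> UNIV \<times> D" for ps
    using that by (induction ps) (auto intro!: zero_finite_rank_operators add_finite_rank_operators rank_one_FR)
  have zero: "\<beta> 0 b = 0" "\<beta> b 0 = 0" if "b \<in> FR" for b
    using add_left[OF zero_finite_rank_operators zero_finite_rank_operators that]
      add_right[OF that zero_finite_rank_operators zero_finite_rank_operators] by simp_all
  have one: "induced ((E x f o\<^sub>L rank_one_sum qs) - (rank_one_sum qs o\<^sub>L E x f)) (\<beta> (E x f) (rank_one_sum qs))"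
    if "f \<in> D" "set qs \<subseteq> UNIV \<times> D" for x f qs
    using that(2)
  proof (induction qs)
    case Nil
    then show ?case using induced_zero zero[OF rank_one_FR[OF that(1)]] by simp
  next
    case (Cons q qs)
    obtain y g where q: "q = (y, g)" by fastforce
    with Cons have g: "g \<in> D" and qs: "set qs \<subseteq> UNIV \<times> D" by auto
    have "induced (((E x f o\<^sub>L E y g) - (E y g o\<^sub>L E x f)) + ((E x f o\<^sub>L rank_one_sum qs) - (rank_one_sum qs o\<^sub>L E x f)))
      (\<beta> (E x f) (E y g) + \<beta> (E x f) (rank_one_sum qs))"
      by (intro induced_add induced_rank_one that(1) g Cons.IH qs)
    then show ?case
      by (simp add: q add_right rank_one_FR that(1) g sumF qs bounded_bilinear.add_left[OF bounded_bilinear_blinfun_compose]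
          bounded_bilinear.add_right[OF bounded_bilinear_blinfun_compose] algebra_simps)
  qed
  have two: "induced ((rank_one_sum ps o\<^sub>L rank_one_sum qs) - (rank_one_sum qs o\<^sub>L rank_one_sum ps))
      (\<beta> (rank_one_sum ps) (rank_one_sum qs))"
    if "set ps \<subseteq> UNIV \<times> D" "set qs \<subseteq> UNIV \<times> D" for ps qs
    using that(1)
  proof (induction ps)
    case Nil
    then show ?case using induced_zero zero[OF sumF[OF that(2)]] by simp
  next
    case (Cons p ps)
    obtain x f where p: "p = (x, f)" by fastforce
    with Cons have f: "f \<in> D" and ps: "set ps \<subseteq> UNIV \<times> D" by auto
    have "induced (((E x f o\<^sub>L rank_one_sum qs) - (rank_one_sum qs o\<^sub>L E x f))
        + ((rank_one_sum ps o\<^sub>L rank_one_sum qs) - (rank_one_sum qs o\<^sub>L rank_one_sum ps)))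
      (\<beta> (E x f) (rank_one_sum qs) + \<beta> (rank_one_sum ps) (rank_one_sum qs))"
      by (intro induced_add one that(2) f Cons.IH ps)
    then show ?case
      by (simp add: p add_left rank_one_FR f sumF ps that(2) bounded_bilinear.add_left[OF bounded_bilinear_blinfun_compose]
          bounded_bilinear.add_right[OF bounded_bilinear_blinfun_compose] algebra_simps)
  qed
  obtain ps where ps: "set ps \<subseteq> UNIV \<times> D" "a = rank_one_sum ps"
    by (rule finite_rank_operator_decomposition[OF assms(1)])
  obtain qs where qs: "set qs \<subseteq> UNIV \<times> D" "b = rank_one_sum qs"
    by (rule finite_rank_operator_decomposition[OF assms(2)])
  show ?thesis
    unfolding ps(2) qs(2) by (rule two[OF ps(1) qs(1)])
qed

lemma sum_beta_zero_aux:
  assumes "finite I" "\<And>i. i \<in> I \<Longrightarrow> a i \<in> FR" "\<And>i. i \<in> I \<Longrightarrow> b i \<in> FR"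
    and "(\<Sum>i\<in>I. a i o\<^sub>L b i) = (\<Sum>i\<in>I. b i o\<^sub>L a i)"
  shows "(\<Sum>i\<in>I. \<beta> (a i) (b i)) = 0"
proof -
  have "induced (\<Sum>i\<in>I. (a i o\<^sub>L b i) - (b i o\<^sub>L a i)) (\<Sum>i\<in>I. \<beta> (a i) (b i))"
    using assms(1-3) by (induction I) (auto intro!: induced_zero induced_add induced_commutator)
  then show ?thesis
    using assms(4) induced_zeroD by (simp add: sum_subtractf)
qed

end

text \<open>The sum is the value of the induced functional at the sum of the commutators, which is
  0. A reference pair with \<open>f0 x0 = 1\<close> exists by rescaling unless all bounded
  functionals vanish; in that case 0 is the only finite rank operator.\<close>

lemma sum_form_zero_if_commutators_cancel:
  assumes "finite I" "\<And>i. i \<in> I \<Longrightarrow> a i \<in> FR" "\<And>i. i \<in> I \<Longrightarrow> b i \<in> FR"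
    and "(\<Sum>i\<in>I. a i o\<^sub>L b i) = (\<Sum>i\<in>I. b i o\<^sub>L a i)"
  shows "(\<Sum>i\<in>I. \<beta> (a i) (b i)) = 0"
proof (cases "\<exists>f\<in>D. \<exists>x. f x \<noteq> 0")
  case True
  then obtain f x where f: "f \<in> D" "f x \<noteq> 0" by blast
  then have "f (sc (inverse (f x)) x) = 1"
    by (simp add: functional_scale)
  from sum_beta_zero_aux[OF f(1) this assms] show ?thesis .
next
  case False
  have "a = 0" if a: "a \<in> FR" for a
  proof -
    obtain ps where ps: "set ps \<subseteq> UNIV \<times> D" "a = rank_one_sum ps"
      by (rule finite_rank_operator_decomposition[OF a])
    have "rank_one sc x f = 0" if "f \<in> D" for x f
      using False that by (intro blinfun_eqI) (simp add: rank_one_apply)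
    then have "rank_one_sum ps = 0"
      using ps(1) by (induction ps) auto
    with ps(2) show ?thesis by simp
  qed
  moreover have "\<beta> 0 0 = 0"
    using beta_self[OF zero_finite_rank_operators] .
  ultimately show ?thesis
    using assms(2,3) by (intro sum.neutral ballI) metis
qed

end

end

section \<open>Tensor products and the projective norm\<close>

interpretation functional_space: vector_space "fun_scale :: 'k::field \<Rightarrow> ('k, 'b, 'c) functional \<Rightarrow> _"
  by unfold_locales (auto simp: fun_scale_def fun_eq_iff algebra_simps)

lemma sum_fun_apply: "(\<Sum>i\<in>A. f i) x = (\<Sum>i\<in>A. f i x)"
  by (induction A rule: infinite_finite_induct) auto

lemma opposite_simps [simp]:
  "elems (opposite A) = elems A" "smul (opposite A) = smul A" "nrm (opposite A) = nrm A"
  "mul (opposite A) = (\<lambda>a b. mul A b a)"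
  by (simp_all add: opposite_def)

locale unital_normed_algebra =
  fixes B :: "('k::real_normed_field, 'b::ab_group_add) unital_normed_alg"
  assumes zero_closed: "0 \<in> elems B"
    and add_closed: "a \<in> elems B \<Longrightarrow> b \<in> elems B \<Longrightarrow> a + b \<in> elems B"
    and uminus_closed: "a \<in> elems B \<Longrightarrow> - a \<in> elems B"
    and smul_closed: "a \<in> elems B \<Longrightarrow> smul B s a \<in> elems B"
    and mul_closed: "a \<in> elems B \<Longrightarrow> b \<in> elems B \<Longrightarrow> mul B a b \<in> elems B"
    and unit_closed: "unit_elem B \<in> elems B"
    and mul_add_left: "a \<in> elems B \<Longrightarrow> b \<in> elems B \<Longrightarrow> c \<in> elems B
      \<Longrightarrow> mul B (a + b) c = mul B a c + mul B b c"
    and mul_add_right: "a \<in> elems B \<Longrightarrow> b \<in> elems B \<Longrightarrow> c \<in> elems B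
      \<Longrightarrow> mul B a (b + c) = mul B a b + mul B a c"
    and mul_smul_left: "a \<in> elems B \<Longrightarrow> b \<in> elems B \<Longrightarrow> mul B (smul B s a) b = smul B s (mul B a b)"
    and mul_smul_right: "a \<in> elems B \<Longrightarrow> b \<in> elems B \<Longrightarrow> mul B a (smul B s b) = smul B s (mul B a b)"
    and mul_assoc: "a \<in> elems B \<Longrightarrow> b \<in> elems B \<Longrightarrow> c \<in> elems B
      \<Longrightarrow> mul B (mul B a b) c = mul B a (mul B b c)"
    and mul_unit_left: "a \<in> elems B \<Longrightarrow> mul B (unit_elem B) a = a"
    and mul_unit_right: "a \<in> elems B \<Longrightarrow> mul B a (unit_elem B) = a"
    and nrm_nonneg: "0 \<le> nrm B a"
    and nrm_smul: "a \<in> elems B \<Longrightarrow> nrm B (smul B s a) = norm s * nrm B a"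
    and nrm_mul: "a \<in> elems B \<Longrightarrow> b \<in> elems B \<Longrightarrow> nrm B (mul B a b) \<le> nrm B a * nrm B b"
begin

abbreviation "bil \<equiv> bilinear_form B (opposite B)"
abbreviation "tp \<equiv> tensor B (opposite B)"
abbreviation "tm \<equiv> tensor_mult B (opposite B)"
abbreviation "V \<equiv> alg_tensor_product B (opposite B)"
abbreviation "pn \<equiv> projective_norm B (opposite B)"
abbreviation "\<o> \<equiv> unit_elem B"

lemmas closed = zero_closed add_closed uminus_closed smul_closed mul_closed unit_closed

lemma sum_closed: "(\<And>i. i \<in> I \<Longrightarrow> a i \<in> elems B) \<Longrightarrow> (\<Sum>i\<in>I. a i) \<in> elems B"
  by (induction I rule: infinite_finite_induct) (auto intro: closed)

lemma mul_zero: "a \<in> elems B \<Longrightarrow> mul B 0 a = 0" "a \<in> elems B \<Longrightarrow> mul B a 0 = 0"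
  using mul_add_left[of 0 0 a] mul_add_right[of a 0 0] zero_closed by simp_all

lemma mul_sum_left: "finite I \<Longrightarrow> (\<And>i. i \<in> I \<Longrightarrow> a i \<in> elems B) \<Longrightarrow> b \<in> elems B
    \<Longrightarrow> mul B (\<Sum>i\<in>I. a i) b = (\<Sum>i\<in>I. mul B (a i) b)"
  by (induction I rule: finite_induct) (auto simp: mul_zero mul_add_left sum_closed)

lemma mul_sum_right: "finite I \<Longrightarrow> (\<And>i. i \<in> I \<Longrightarrow> a i \<in> elems B) \<Longrightarrow> b \<in> elems B
    \<Longrightarrow> mul B b (\<Sum>i\<in>I. a i) = (\<Sum>i\<in>I. mul B b (a i))"
  by (induction I rule: finite_induct) (auto simp: mul_zero mul_add_right sum_closed)

lemma
  assumes "bil \<phi>"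
  shows bil_add_left: "a \<in> elems B \<Longrightarrow> a' \<in> elems B \<Longrightarrow> c \<in> elems B \<Longrightarrow> \<phi> (a + a') c = \<phi> a c + \<phi> a' c"
    and bil_add_right: "a \<in> elems B \<Longrightarrow> c \<in> elems B \<Longrightarrow> c' \<in> elems B \<Longrightarrow> \<phi> a (c + c') = \<phi> a c + \<phi> a c'"
    and bil_smul_left: "a \<in> elems B \<Longrightarrow> c \<in> elems B \<Longrightarrow> \<phi> (smul B s a) c = s * \<phi> a c"
    and bil_smul_right: "a \<in> elems B \<Longrightarrow> c \<in> elems B \<Longrightarrow> \<phi> a (smul B s c) = s * \<phi> a c"
  using assms by (simp_all add: bilinear_form_def)

lemma bilI:
  assumes "\<And>a a' c. a \<in> elems B \<Longrightarrow> a' \<in> elems B \<Longrightarrow> c \<in> elems B \<Longrightarrow> \<phi> (a + a') c = \<phi> a c + \<phi> a' c"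
    and "\<And>a c c'. a \<in> elems B \<Longrightarrow> c \<in> elems B \<Longrightarrow> c' \<in> elems B \<Longrightarrow> \<phi> a (c + c') = \<phi> a c + \<phi> a c'"
    and "\<And>s a c. a \<in> elems B \<Longrightarrow> c \<in> elems B \<Longrightarrow> \<phi> (smul B s a) c = s * \<phi> a c"
    and "\<And>s a c. a \<in> elems B \<Longrightarrow> c \<in> elems B \<Longrightarrow> \<phi> a (smul B s c) = s * \<phi> a c"
  shows "bil \<phi>"
  using assms by (simp add: bilinear_form_def)

lemma tp_apply: "bil \<phi> \<Longrightarrow> tp a c \<phi> = \<phi> a c"
  and tp_not_bil: "\<not> bil \<phi> \<Longrightarrow> tp a c \<phi> = 0"
  by (simp_all add: tensor_def)

section \<open>Bilinearity of elementary tensors\<close>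

lemma tp_add_left: "a \<in> elems B \<Longrightarrow> a' \<in> elems B \<Longrightarrow> c \<in> elems B \<Longrightarrow> tp (a + a') c = tp a c + tp a' c"
  by (rule ext) (simp add: tensor_def bil_add_left)

lemma tp_add_right: "a \<in> elems B \<Longrightarrow> c \<in> elems B \<Longrightarrow> c' \<in> elems B \<Longrightarrow> tp a (c + c') = tp a c + tp a c'"
  by (rule ext) (simp add: tensor_def bil_add_right)

lemma tp_smul_left: "a \<in> elems B \<Longrightarrow> c \<in> elems B \<Longrightarrow> tp (smul B s a) c = fun_scale s (tp a c)"
  by (rule ext) (simp add: tensor_def fun_scale_def bil_smul_left)

lemma tp_smul_right: "a \<in> elems B \<Longrightarrow> c \<in> elems B \<Longrightarrow> tp a (smul B s c) = fun_scale s (tp a c)"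
  by (rule ext) (simp add: tensor_def fun_scale_def bil_smul_right)

lemma tp_zero: "c \<in> elems B \<Longrightarrow> tp 0 c = 0" "c \<in> elems B \<Longrightarrow> tp c 0 = 0"
  using tp_add_left[of 0 0 c] tp_add_right[of c 0 0] zero_closed by simp_all

lemma tp_uminus: "a \<in> elems B \<Longrightarrow> c \<in> elems B \<Longrightarrow> tp (- a) c = - tp a c"
    "a \<in> elems B \<Longrightarrow> c \<in> elems B \<Longrightarrow> tp a (- c) = - tp a c"
  using tp_add_left[of a "- a" c] tp_add_right[of a c "- c"]
  by (simp_all add: uminus_closed tp_zero eq_neg_iff_add_eq_0 add.commute)

lemma tp_diff_left: "a \<in> elems B \<Longrightarrow> a' \<in> elems B \<Longrightarrow> c \<in> elems B \<Longrightarrow> tp (a - a') c = tp a c - tp a' c"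
  using tp_add_left[of a "- a'" c] by (simp add: uminus_closed tp_uminus)

lemma tp_diff_right: "a \<in> elems B \<Longrightarrow> c \<in> elems B \<Longrightarrow> c' \<in> elems B \<Longrightarrow> tp a (c - c') = tp a c - tp a c'"
  using tp_add_right[of a c "- c'"] by (simp add: uminus_closed tp_uminus)

lemma tp_sum_right: "finite I \<Longrightarrow> (\<And>i. i \<in> I \<Longrightarrow> c i \<in> elems B) \<Longrightarrow> a \<in> elems B
    \<Longrightarrow> tp a (\<Sum>i\<in>I. c i) = (\<Sum>i\<in>I. tp a (c i))"
  by (induction I rule: finite_induct) (auto simp: tp_zero tp_add_right sum_closed)

section \<open>The projective norm as a seminorm\<close>

lemma V_elim:
  assumes "u \<in> V"
  obtains n :: nat and a c where "\<And>k. k < n \<Longrightarrow> a k \<in> elems B" "\<And>k. k < n \<Longrightarrow> c k \<in> elems B"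
    "u = (\<Sum>k<n. tp (a k) (c k))"
  using assms unfolding alg_tensor_product_def by auto

definition representation_norms :: "('k, 'b, 'b) functional \<Rightarrow> real set" where
  "representation_norms u = {\<Sum>k<n. nrm B (a k) * nrm B (c k) | (n::nat) a c.
    (\<forall>k<n. a k \<in> elems B \<and> c k \<in> elems B) \<and> u = (\<Sum>k<n. tp (a k) (c k))}"

lemma pn_eq: "pn u = Inf (representation_norms u)"
  by (simp add: projective_norm_def representation_norms_def)

lemma representation_norms_sum:
  assumes "finite I" "\<And>i. i \<in> I \<Longrightarrow> a i \<in> elems B" "\<And>i. i \<in> I \<Longrightarrow> c i \<in> elems B"
  shows "(\<Sum>i\<in>I. nrm B (a i) * nrm B (c i)) \<in> representation_norms (\<Sum>i\<in>I. tp (a i) (c i))"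
proof -
  obtain h where h: "bij_betw h {..<card I} I"
    using ex_bij_betw_nat_finite[OF assms(1)] by (auto simp: atLeast0LessThan)
  have mem: "\<forall>k<card I. a (h k) \<in> elems B \<and> c (h k) \<in> elems B"
    using assms(2,3) bij_betwE[OF h] by simp
  show ?thesis
    unfolding representation_norms_def
    by (rule CollectI, rule exI[of _ "card I"], rule exI[of _ "\<lambda>k. a (h k)"], rule exI[of _ "\<lambda>k. c (h k)"])
      (simp add: mem sum.reindex_bij_betw[OF h, of "\<lambda>i. tp (a i) (c i)"]
        sum.reindex_bij_betw[OF h, of "\<lambda>i. nrm B (a i) * nrm B (c i)"])
qed

lemma V_iff_representation_norms: "u \<in> V \<longleftrightarrow> representation_norms u \<noteq> {}"
  unfolding alg_tensor_product_def representation_norms_def by auto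

lemma sum_tp_in_V:
  assumes "finite I" "\<And>i. i \<in> I \<Longrightarrow> a i \<in> elems B" "\<And>i. i \<in> I \<Longrightarrow> c i \<in> elems B"
  shows "(\<Sum>i\<in>I. tp (a i) (c i)) \<in> V"
  unfolding V_iff_representation_norms using representation_norms_sum[of I a c, OF assms] by blast

lemma representation_norms_nonneg: "t \<in> representation_norms u \<Longrightarrow> 0 \<le> t"
  unfolding representation_norms_def by (auto intro!: sum_nonneg mult_nonneg_nonneg nrm_nonneg)

lemma pn_nonneg: "u \<in> V \<Longrightarrow> 0 \<le> pn u"
  unfolding pn_eq V_iff_representation_norms
  by (intro cInf_greatest representation_norms_nonneg)

lemma pn_sum_le:
  assumes "finite I" "\<And>i. i \<in> I \<Longrightarrow> a i \<in> elems B" "\<And>i. i \<in> I \<Longrightarrow> c i \<in> elems B"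
  shows "pn (\<Sum>i\<in>I. tp (a i) (c i)) \<le> (\<Sum>i\<in>I. nrm B (a i) * nrm B (c i))"
  unfolding pn_eq
  by (intro cInf_lower representation_norms_sum assms bdd_belowI[where m = 0] representation_norms_nonneg)

lemma pn_tp_le: "a \<in> elems B \<Longrightarrow> c \<in> elems B \<Longrightarrow> pn (tp a c) \<le> nrm B a * nrm B c"
  using pn_sum_le[of "{()}" "\<lambda>_. a" "\<lambda>_. c"] by simp

lemma pn_approx:
  assumes "u \<in> V" "0 < e"
  obtains n :: nat and a c where "\<And>k. k < n \<Longrightarrow> a k \<in> elems B" "\<And>k. k < n \<Longrightarrow> c k \<in> elems B"
    "u = (\<Sum>k<n. tp (a k) (c k))" "(\<Sum>k<n. nrm B (a k) * nrm B (c k)) < pn u + e"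
proof -
  have "Inf (representation_norms u) < pn u + e"
    using assms(2) by (simp add: pn_eq)
  then obtain t where "t \<in> representation_norms u" "t < pn u + e"
    using cInf_lessD[of "representation_norms u"] assms(1) by (auto simp: V_iff_representation_norms)
  then show ?thesis
    using that unfolding representation_norms_def by blast
qed

lemma sum_tp_add:
  fixes n m :: nat
  shows "(\<Sum>k<n. tp (a k) (c k)) + (\<Sum>k<m. tp (a' k) (c' k))
    = (\<Sum>i\<in>{..<n} <+> {..<m}. tp (case_sum a a' i) (case_sum c c' i))"
  by (simp add: sum.Plus)

lemma V_add: assumes "u \<in> V" "v \<in> V" shows "u + v \<in> V"
proof -
  obtain n :: nat and a c where u: "\<And>k. k < n \<Longrightarrow> a k \<in> elems B" "\<And>k. k < n \<Longrightarrow> c k \<in> elems B"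
    "u = (\<Sum>k<n. tp (a k) (c k))" using V_elim[OF assms(1)] by blast
  obtain m :: nat and a' c' where v: "\<And>k. k < m \<Longrightarrow> a' k \<in> elems B" "\<And>k. k < m \<Longrightarrow> c' k \<in> elems B"
    "v = (\<Sum>k<m. tp (a' k) (c' k))" using V_elim[OF assms(2)] by blast
  show ?thesis
    unfolding u(3) v(3) sum_tp_add by (intro sum_tp_in_V) (auto simp: u v)
qed

lemma pn_triangle: assumes "u \<in> V" "v \<in> V" shows "pn (u + v) \<le> pn u + pn v"
proof (rule field_le_epsilon)
  fix e :: real assume "0 < e"
  then have e: "0 < e / 2" by simp
  obtain n :: nat and a c where u: "\<And>k. k < n \<Longrightarrow> a k \<in> elems B" "\<And>k. k < n \<Longrightarrow> c k \<in> elems B"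
    "u = (\<Sum>k<n. tp (a k) (c k))" "(\<Sum>k<n. nrm B (a k) * nrm B (c k)) < pn u + e / 2"
    using pn_approx[OF assms(1) e] by blast
  obtain m :: nat and a' c' where v: "\<And>k. k < m \<Longrightarrow> a' k \<in> elems B" "\<And>k. k < m \<Longrightarrow> c' k \<in> elems B"
    "v = (\<Sum>k<m. tp (a' k) (c' k))" "(\<Sum>k<m. nrm B (a' k) * nrm B (c' k)) < pn v + e / 2"
    using pn_approx[OF assms(2) e] by blast
  have "pn (u + v) \<le> (\<Sum>i\<in>{..<n} <+> {..<m}. nrm B (case_sum a a' i) * nrm B (case_sum c c' i))"
    unfolding u(3) v(3) sum_tp_add by (intro pn_sum_le) (auto simp: u v)
  then show "pn (u + v) \<le> pn u + pn v + e"
    using u(4) v(4) by (simp add: sum.Plus)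
qed

lemma fun_scale_sum: "fun_scale s (\<Sum>i\<in>I. f i) = (\<Sum>i\<in>I. fun_scale s (f i))"
  by (rule functional_space.scale_sum_right)

lemma V_scale: assumes "u \<in> V" shows "fun_scale s u \<in> V"
proof -
  obtain n :: nat and a c where u: "\<And>k. k < n \<Longrightarrow> a k \<in> elems B" "\<And>k. k < n \<Longrightarrow> c k \<in> elems B"
    "u = (\<Sum>k<n. tp (a k) (c k))" using V_elim[OF assms(1)] by blast
  have "fun_scale s u = (\<Sum>k<n. tp (smul B s (a k)) (c k))"
    using u by (simp add: fun_scale_sum tp_smul_left)
  also have "\<dots> \<in> V"
    by (intro sum_tp_in_V) (auto simp: u closed)
  finally show ?thesis .
qed

lemma pn_scale_le: assumes "u \<in> V" shows "pn (fun_scale s u) \<le> norm s * pn u"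
proof (rule field_le_epsilon)
  fix e :: real assume e: "0 < e"
  \<comment> \<open>The added 1 keeps the divisor positive when \<open>s = 0\<close>.\<close>
  define d where "d = e / (norm s + 1)"
  have s: "0 < norm s + 1" by (simp add: add_nonneg_pos)
  have d: "0 < d" "norm s * d \<le> e"
    using e s by (simp_all add: d_def field_simps)
  obtain n :: nat and a c where u: "\<And>k. k < n \<Longrightarrow> a k \<in> elems B" "\<And>k. k < n \<Longrightarrow> c k \<in> elems B"
    "u = (\<Sum>k<n. tp (a k) (c k))" "(\<Sum>k<n. nrm B (a k) * nrm B (c k)) < pn u + d"
    using pn_approx[OF assms d(1)] by blast
  have "fun_scale s u = (\<Sum>k<n. tp (smul B s (a k)) (c k))"
    using u by (simp add: fun_scale_sum tp_smul_left)
  then have "pn (fun_scale s u) \<le> (\<Sum>k<n. nrm B (smul B s (a k)) * nrm B (c k))"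
    by (simp only:, intro pn_sum_le) (auto simp: u closed)
  also have "\<dots> = norm s * (\<Sum>k<n. nrm B (a k) * nrm B (c k))"
    by (simp add: sum_distrib_left nrm_smul u mult.assoc)
  also have "\<dots> \<le> norm s * (pn u + d)"
    using u(4) by (intro mult_left_mono) simp_all
  finally show "pn (fun_scale s u) \<le> norm s * pn u + e"
    using d(2) by (simp add: distrib_left)
qed

lemma V_zero: "0 \<in> V"
  using sum_tp_in_V[of "{}"] by simp

lemma V_subspace: "functional_space.subspace V"
  by (intro functional_space.subspaceI V_zero V_add V_scale)

lemma V_diff: "u \<in> V \<Longrightarrow> v \<in> V \<Longrightarrow> u - v \<in> V"
  using functional_space.subspace_diff[OF V_subspace] .

lemma tp_in_V: "a \<in> elems B \<Longrightarrow> c \<in> elems B \<Longrightarrow> tp a c \<in> V"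
  using sum_tp_in_V[of "{()}" "\<lambda>_. a" "\<lambda>_. c"] by simp

lemma pn_zero: "pn 0 = 0"
  using pn_sum_le[of "{}"] pn_nonneg[OF V_zero] by simp

lemma pn_minus_commute: assumes "u \<in> V" "v \<in> V" shows "pn (u - v) = pn (v - u)"
proof -
  have "pn (u - v) \<le> pn (v - u)" if "u \<in> V" "v \<in> V" for u v
    using pn_scale_le[OF V_diff[OF that(2,1)], of "- 1"] by simp
  from this[OF assms] this[OF assms(2,1)] show ?thesis by simp
qed

section \<open>Products of tensors\<close>

lemma bil_mul_left:
  assumes "bil \<phi>" "a \<in> elems B" "c \<in> elems B"
  shows "bil (\<lambda>a' c'. \<phi> (mul B a a') (mul B c' c))"
  by (rule bilI)
    (simp_all add: assms closed mul_add_left mul_add_right mul_smul_left mul_smul_right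
      bil_add_left bil_add_right bil_smul_left bil_smul_right)

text \<open>An elementary tensor evaluates a bilinear form and is 0 on every other function. The
  definition of the product therefore gives the expected formula only once the function handed to
  the left factor, itself obtained by evaluating the right factor, is known to be bilinear.\<close>

lemma tm_sum:
  assumes "finite I" "\<And>i. i \<in> I \<Longrightarrow> a i \<in> elems B" "\<And>i. i \<in> I \<Longrightarrow> b i \<in> elems B"
    and "finite J" "\<And>j. j \<in> J \<Longrightarrow> c j \<in> elems B" "\<And>j. j \<in> J \<Longrightarrow> d j \<in> elems B"
  shows "tm (\<Sum>i\<in>I. tp (a i) (b i)) (\<Sum>j\<in>J. tp (c j) (d j))
    = (\<Sum>(i, j)\<in>I \<times> J. tp (mul B (a i) (c j)) (mul B (d j) (b i)))"
proof
  fix \<phi>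
  show "tm (\<Sum>i\<in>I. tp (a i) (b i)) (\<Sum>j\<in>J. tp (c j) (d j)) \<phi>
    = (\<Sum>(i, j)\<in>I \<times> J. tp (mul B (a i) (c j)) (mul B (d j) (b i))) \<phi>"
  proof (cases "bil \<phi>")
    case False
    then show ?thesis
      by (simp add: tensor_mult_def sum_fun_apply tp_not_bil case_prod_unfold)
  next
    case True
    define \<psi> where "\<psi> x y = (\<Sum>j\<in>J. tp (c j) (d j)) (\<lambda>a' c'. \<phi> (mul B x a') (mul B c' y))" for x y
    have \<psi>: "\<psi> x y = (\<Sum>j\<in>J. \<phi> (mul B x (c j)) (mul B (d j) y))" if "x \<in> elems B" "y \<in> elems B" for x y
      unfolding \<psi>_def sum_fun_apply by (simp add: tp_apply bil_mul_left True that)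
    have "bil \<psi>"
      by (rule bilI)
        (simp_all add: \<psi> closed assms(5,6) mul_add_left mul_add_right mul_smul_left mul_smul_right
          bil_add_left[OF True] bil_add_right[OF True] bil_smul_left[OF True] bil_smul_right[OF True]
          sum.distrib sum_distrib_left)
    then have "(\<Sum>i\<in>I. tp (a i) (b i)) \<psi> = (\<Sum>i\<in>I. \<psi> (a i) (b i))"
      by (simp add: sum_fun_apply tp_apply)
    also have "\<dots> = (\<Sum>(i, j)\<in>I \<times> J. tp (mul B (a i) (c j)) (mul B (d j) (b i)) \<phi>)"
      by (simp add: \<psi> assms tp_apply True sum.cartesian_product)
    finally show ?thesis
      using True unfolding tensor_mult_def \<psi>_def by (simp add: sum_fun_apply case_prod_unfold)
  qed
qed

lemma tm_tp: "a \<in> elems B \<Longrightarrow> b \<in> elems B \<Longrightarrow> c \<in> elems B \<Longrightarrow> d \<in> elems B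
    \<Longrightarrow> tm (tp a b) (tp c d) = tp (mul B a c) (mul B d b)"
  using tm_sum[of "{()}" "\<lambda>_. a" "\<lambda>_. b" "{()}" "\<lambda>_. c" "\<lambda>_. d"] by (simp add: case_prod_unfold)

lemma tm_in_V: assumes "u \<in> V" "v \<in> V" shows "tm u v \<in> V"
proof -
  obtain n :: nat and a c where u: "\<And>k. k < n \<Longrightarrow> a k \<in> elems B" "\<And>k. k < n \<Longrightarrow> c k \<in> elems B"
    "u = (\<Sum>k<n. tp (a k) (c k))" using V_elim[OF assms(1)] by blast
  obtain m :: nat and a' c' where v: "\<And>k. k < m \<Longrightarrow> a' k \<in> elems B" "\<And>k. k < m \<Longrightarrow> c' k \<in> elems B"
    "v = (\<Sum>k<m. tp (a' k) (c' k))" using V_elim[OF assms(2)] by blast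
  have "tm u v = (\<Sum>(i, j)\<in>{..<n} \<times> {..<m}. tp (mul B (a i) (a' j)) (mul B (c' j) (c i)))"
    unfolding u(3) v(3) by (intro tm_sum) (simp_all add: u v)
  also have "\<dots> \<in> V"
    unfolding case_prod_unfold by (intro sum_tp_in_V) (auto simp: u v closed)
  finally show ?thesis .
qed

lemma pn_tm_le: assumes "u \<in> V" "v \<in> V" shows "pn (tm u v) \<le> pn u * pn v"
proof -
  have *: "pn (tm u v) \<le> (pn u + e) * (pn v + e)" if e: "0 < e" for e
  proof -
    obtain n :: nat and a c where u: "\<And>k. k < n \<Longrightarrow> a k \<in> elems B" "\<And>k. k < n \<Longrightarrow> c k \<in> elems B"
      "u = (\<Sum>k<n. tp (a k) (c k))" "(\<Sum>k<n. nrm B (a k) * nrm B (c k)) < pn u + e"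
      using pn_approx[OF assms(1) e] by blast
    obtain m :: nat and a' c' where v: "\<And>k. k < m \<Longrightarrow> a' k \<in> elems B" "\<And>k. k < m \<Longrightarrow> c' k \<in> elems B"
      "v = (\<Sum>k<m. tp (a' k) (c' k))" "(\<Sum>k<m. nrm B (a' k) * nrm B (c' k)) < pn v + e"
      using pn_approx[OF assms(2) e] by blast
    have "tm u v = (\<Sum>p\<in>{..<n} \<times> {..<m}. tp (mul B (a (fst p)) (a' (snd p))) (mul B (c' (snd p)) (c (fst p))))"
      unfolding u(3) v(3) by (subst tm_sum) (simp_all add: u v case_prod_unfold)
    then have "pn (tm u v) \<le> (\<Sum>p\<in>{..<n} \<times> {..<m}.
        nrm B (mul B (a (fst p)) (a' (snd p))) * nrm B (mul B (c' (snd p)) (c (fst p))))"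
      by (simp only:, intro pn_sum_le) (auto simp: u v closed)
    also have "\<dots> \<le> (\<Sum>p\<in>{..<n} \<times> {..<m}. (nrm B (a (fst p)) * nrm B (a' (snd p)))
        * (nrm B (c' (snd p)) * nrm B (c (fst p))))"
      by (intro sum_mono mult_mono nrm_mul mult_nonneg_nonneg nrm_nonneg) (auto simp: u v)
    also have "\<dots> = (\<Sum>k<n. nrm B (a k) * nrm B (c k)) * (\<Sum>k<m. nrm B (a' k) * nrm B (c' k))"
      unfolding sum_product sum.cartesian_product case_prod_unfold by (simp only: ac_simps)
    also have "\<dots> \<le> (pn u + e) * (pn v + e)"
      using u(4) v(4) pn_nonneg[OF assms(1)] e
      by (intro mult_mono sum_nonneg mult_nonneg_nonneg nrm_nonneg) simp_all
    finally show ?thesis .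
  qed
  \<comment> \<open>Almost optimal representations lose \<open>e\<close> in each factor; the loss
    disappears as \<open>e\<close> tends to 0 from the right.\<close>
  have "((\<lambda>e. (pn u + e) * (pn v + e)) \<longlongrightarrow> (pn u + 0) * (pn v + 0)) (at_right 0)"
    by (intro tendsto_intros)
  then have "pn (tm u v) \<le> (pn u + 0) * (pn v + 0)"
    by (rule tendsto_lowerbound) (auto simp: eventually_at_filter * intro: always_eventually)
  then show ?thesis by simp
qed

lemma tm_diff_left: "tm (u - v) w = tm u w - tm v w"
  by (rule ext) (simp add: tensor_mult_def)

text \<open>In contrast to the left argument, the difference now sits inside the function to which
  \<open>u\<close> is applied, and \<open>u\<close> is additive on bilinear forms. So
  \<open>v\<close> and \<open>w\<close> must yield bilinear forms, which membership in
  \<open>V\<close> ensures.\<close>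

lemma tm_diff_right:
  assumes "u \<in> V" "v \<in> V" "w \<in> V"
  shows "tm u (v - w) = tm u v - tm u w"
proof
  fix \<phi>
  obtain n :: nat and a c where u: "\<And>k. k < n \<Longrightarrow> a k \<in> elems B" "\<And>k. k < n \<Longrightarrow> c k \<in> elems B"
    "u = (\<Sum>k<n. tp (a k) (c k))" using V_elim[OF assms(1)] by blast
  have *: "bil (\<lambda>a c. v (\<lambda>a' c'. \<phi> (mul B a a') (mul B c' c)))" if \<phi>: "bil \<phi>" and vV: "v \<in> V" for v
  proof -
    obtain n :: nat and a c where v: "\<And>k. k < n \<Longrightarrow> a k \<in> elems B" "\<And>k. k < n \<Longrightarrow> c k \<in> elems B"
      "v = (\<Sum>k<n. tp (a k) (c k))" using V_elim[OF vV] by blast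
    have eq: "v (\<lambda>a' c'. \<phi> (mul B x a') (mul B c' y)) = (\<Sum>k<n. \<phi> (mul B x (a k)) (mul B (c k) y))"
      if "x \<in> elems B" "y \<in> elems B" for x y
      unfolding v(3) sum_fun_apply by (simp add: tp_apply bil_mul_left \<phi> that)
    show ?thesis
      by (rule bilI)
        (simp_all add: eq closed v(1,2) mul_add_left mul_add_right mul_smul_left mul_smul_right
          bil_add_left[OF \<phi>] bil_add_right[OF \<phi>] bil_smul_left[OF \<phi>]
          bil_smul_right[OF \<phi>] sum.distrib sum_distrib_left)
  qed
  have diff: "u (\<lambda>a c. \<psi> a c - \<psi>' a c) = u \<psi> - u \<psi>'" if "bil \<psi>" "bil \<psi>'" for \<psi> \<psi>'
  proof -
    have "bil (\<lambda>a c. \<psi> a c - \<psi>' a c)"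
      by (rule bilI) (simp_all add: bil_add_left[OF that(1)] bil_add_right[OF that(1)]
          bil_smul_left[OF that(1)] bil_smul_right[OF that(1)] bil_add_left[OF that(2)]
          bil_add_right[OF that(2)] bil_smul_left[OF that(2)] bil_smul_right[OF that(2)]
          right_diff_distrib)
    then show ?thesis
      using that by (simp add: u(3) sum_fun_apply tp_apply sum_subtractf)
  qed
  show "tm u (v - w) \<phi> = (tm u v - tm u w) \<phi>"
  proof (cases "bil \<phi>")
    case True
    with diff[OF *[OF True assms(2)] *[OF True assms(3)]] show ?thesis
      by (simp add: tensor_mult_def)
  qed (simp add: tensor_mult_def)
qed

end

section \<open>Commutator tensors\<close>

interpretation functional_pair: vector_space_pair
  "fun_scale :: 'k::field \<Rightarrow> ('k, 'b, 'c) functional \<Rightarrow> _" "(*) :: 'k \<Rightarrow> 'k \<Rightarrow> 'k"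
  by unfold_locales (auto simp: algebra_simps)

text \<open>Purely algebraic: a basis of \<open>T\<close> together with \<open>u\<close> is
  independent, and a functional may be prescribed on it. No norm is involved, so the argument
  applies to \<open>T_Lie\<close> itself and not only to its closure.\<close>

lemma subspace_separating_functional:
  fixes T :: "('k::field, 'b, 'c) functional set"
  assumes T: "functional_space.subspace T" and u: "u \<notin> T"
  obtains l :: "('k, 'b, 'c) functional \<Rightarrow> 'k"
  where "Vector_Spaces.linear fun_scale (*) l" "\<And>t. t \<in> T \<Longrightarrow> l t = 0" "l u \<noteq> 0"
proof -
  obtain S where S: "S \<subseteq> T" "functional_space.independent S" "T \<subseteq> functional_space.span S"
    using functional_space.maximal_independent_subset by blast
  have "functional_space.span S \<subseteq> T"
    using S(1) T by (rule functional_space.span_minimal)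
  with u have u': "u \<notin> functional_space.span S" by blast
  then have "functional_space.independent (insert u S)"
    using S(2) by (simp add: functional_space.independent_insert)
  from functional_pair.linear_independent_extend[OF this, of "\<lambda>x. if x = u then 1 else 0"]
  obtain l where l: "Vector_Spaces.linear fun_scale (*) l"
    "\<forall>x\<in>insert u S. l x = (if x = u then 1 else 0)" by blast
  have "l t = 0" if "t \<in> T" for t
  proof (rule functional_pair.linear_eq_0_on_span[OF l(1)])
    show "l x = 0" if "x \<in> S" for x
      using l(2) that u' functional_space.span_base[of x S] by auto
    show "t \<in> functional_space.span S" using that S(3) by blast
  qed
  with l that show ?thesis by simp
qed

context unital_normed_algebra
begin

lemma V_subalgebra: "subalgebra B (opposite B) V"
  by (simp add: subalgebra_def V_subspace tm_in_V)

definition commutator_tensor :: "'b \<Rightarrow> ('k, 'b, 'b) functional" where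
  "commutator_tensor a = tp a \<o> - tp \<o> a"

lemma
  shows commutator_tensor_in_T_Lie: "a \<in> elems B \<Longrightarrow> commutator_tensor a \<in> T_Lie B"
    and T_Lie_subspace: "functional_space.subspace (T_Lie B)"
    and tm_in_T_Lie: "u \<in> T_Lie B \<Longrightarrow> v \<in> T_Lie B \<Longrightarrow> tm u v \<in> T_Lie B"
    and T_Lie_subset_V: "T_Lie B \<subseteq> V"
proof -
  let ?G = "{tp a \<o> - tp \<o> a | a. a \<in> elems B}"
  have T: "T_Lie B = \<Inter>{S. subalgebra B (opposite B) S \<and> ?G \<subseteq> S}"
    by (simp add: T_Lie_def hull_def)
  show "commutator_tensor a \<in> T_Lie B" if "a \<in> elems B"
    unfolding T commutator_tensor_def using that by blast
  show "functional_space.subspace (T_Lie B)"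
    unfolding T by (intro functional_space.subspace_Inter) (auto simp: subalgebra_def)
  show "tm u v \<in> T_Lie B" if "u \<in> T_Lie B" "v \<in> T_Lie B"
    using that unfolding T subalgebra_def by blast
  have "?G \<subseteq> V"
    by (auto intro!: V_diff tp_in_V unit_closed)
  then show "T_Lie B \<subseteq> V"
    unfolding T using V_subalgebra by blast
qed

definition circ :: "'b \<Rightarrow> 'b \<Rightarrow> ('k, 'b, 'b) functional" where
  "circ a b = tp a b - tp \<o> (mul B a b)"

lemma circ_add_left: "a \<in> elems B \<Longrightarrow> a' \<in> elems B \<Longrightarrow> b \<in> elems B
    \<Longrightarrow> circ (a + a') b = circ a b + circ a' b"
  and circ_add_right: "a \<in> elems B \<Longrightarrow> b \<in> elems B \<Longrightarrow> b' \<in> elems B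
    \<Longrightarrow> circ a (b + b') = circ a b + circ a b'"
  and circ_smul_left: "a \<in> elems B \<Longrightarrow> b \<in> elems B \<Longrightarrow> circ (smul B s a) b = fun_scale s (circ a b)"
  and circ_smul_right: "a \<in> elems B \<Longrightarrow> b \<in> elems B \<Longrightarrow> circ a (smul B s b) = fun_scale s (circ a b)"
  by (simp_all add: circ_def tp_add_left tp_add_right mul_add_left mul_add_right closed
      tp_smul_left tp_smul_right mul_smul_left mul_smul_right functional_space.scale_right_diff_distrib)

lemma circ_unit_left: "b \<in> elems B \<Longrightarrow> circ \<o> b = 0"
  by (simp add: circ_def mul_unit_left)

lemma circ_unit_right: "a \<in> elems B \<Longrightarrow> circ a \<o> = commutator_tensor a"
  by (simp add: circ_def commutator_tensor_def mul_unit_right)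

lemma tm_commutator_tensor_tp:
  assumes "a \<in> elems B" "b \<in> elems B" "c \<in> elems B"
  shows "tm (commutator_tensor a) (tp b c) = tp (mul B a b) c - tp b (mul B c a)"
  using assms by (simp add: commutator_tensor_def tm_diff_left tm_tp closed mul_unit_left mul_unit_right)

lemma tm_commutator_tensor:
  assumes a: "a \<in> elems B" and b: "b \<in> elems B"
  shows "tm (commutator_tensor a) (commutator_tensor b)
    = (tp (mul B a b) \<o> - tp b a) - (tp a b - tp \<o> (mul B b a))"
proof -
  have "tm (commutator_tensor a) (commutator_tensor b)
    = tm (commutator_tensor a) (tp b \<o>) - tm (commutator_tensor a) (tp \<o> b)"
    unfolding commutator_tensor_def[of b]
    by (intro tm_diff_right tp_in_V unit_closed b subsetD[OF T_Lie_subset_V] commutator_tensor_in_T_Lie a)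
  then show ?thesis
    by (simp add: tm_commutator_tensor_tp a b closed mul_unit_left mul_unit_right)
qed

text \<open>Write D for \<open>commutator_tensor\<close>. Expanding D(a) D(b) gives both mixed
  tensors with a minus sign, and subtracting it from D(ab) cancels
  \<open>ab \<otimes> 1\<close>.\<close>

lemma circ_symmetric_in_T_Lie:
  assumes a: "a \<in> elems B" and b: "b \<in> elems B"
  shows "circ a b + circ b a \<in> T_Lie B"
proof -
  have "circ a b + circ b a
      = commutator_tensor (mul B a b) - tm (commutator_tensor a) (commutator_tensor b)"
    unfolding tm_commutator_tensor[OF a b] by (simp add: circ_def commutator_tensor_def)
  then show ?thesis
    by (simp add: functional_space.subspace_diff T_Lie_subspace tm_in_T_Lie
        commutator_tensor_in_T_Lie a b closed)
qed

text \<open>Expanding the product of the generators for \<open>a\<close>, \<open>b\<close>,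
  \<open>c\<close> yields a generator for \<open>abc\<close> and six terms:
  \<open>bc \<circ> a\<close>, \<open>ac \<circ> b\<close>, \<open>ab \<circ> c\<close> with a minus
  sign and \<open>c \<circ> ba\<close>, \<open>b \<circ> ca\<close>, \<open>a \<circ> cb\<close>
  with a plus sign. Antisymmetry modulo \<open>T_Lie\<close> turns the last three around and gives
  the symmetric form.\<close>

lemma circ_jordan_in_T_Lie:
  assumes a: "a \<in> elems B" and b: "b \<in> elems B" and c: "c \<in> elems B"
  shows "circ (mul B a b + mul B b a) c + circ (mul B a c + mul B c a) b
    + circ (mul B b c + mul B c b) a \<in> T_Lie B"
proof -
  let ?D = commutator_tensor
  note ab = mul_closed[OF a b] and ba = mul_closed[OF b a] and ac = mul_closed[OF a c]
    and ca = mul_closed[OF c a] and bc = mul_closed[OF b c] and cb = mul_closed[OF c b]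
  have DV: "?D a \<in> V"
    using T_Lie_subset_V commutator_tensor_in_T_Lie[OF a] by blast
  have "tm (?D a) (tm (?D b) (?D c))
      = tm (?D a) (tp (mul B b c) \<o>) - tm (?D a) (tp c b)
        - (tm (?D a) (tp b c) - tm (?D a) (tp \<o> (mul B c b)))"
    unfolding tm_commutator_tensor[OF b c]
    by (simp add: tm_diff_right DV V_diff tp_in_V closed b c)
  also have "\<dots> = tp (mul B a (mul B b c)) \<o> - tp (mul B b c) a
      - (tp (mul B a c) b - tp c (mul B b a))
      - ((tp (mul B a b) c - tp b (mul B c a)) - (tp a (mul B c b) - tp \<o> (mul B (mul B c b) a)))"
    by (simp add: tm_commutator_tensor_tp a b c closed mul_unit_left mul_unit_right)
  also have "\<dots> = ?D (mul B a (mul B b c)) - circ (mul B b c) a - circ (mul B a c) b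
      + circ c (mul B b a) - circ (mul B a b) c + circ b (mul B c a) + circ a (mul B c b)"
    by (simp add: circ_def commutator_tensor_def mul_assoc a b c closed algebra_simps)
  finally have "circ (mul B a b + mul B b a) c + circ (mul B a c + mul B c a) b
      + circ (mul B b c + mul B c b) a
    = ?D (mul B a (mul B b c)) - tm (?D a) (tm (?D b) (?D c))
      + (circ (mul B b a) c + circ c (mul B b a)) + (circ (mul B c a) b + circ b (mul B c a))
      + (circ (mul B c b) a + circ a (mul B c b))"
    by (simp add: circ_add_left ab ba ac ca bc cb a b c)
  then show ?thesis
    by (simp add: functional_space.subspace_diff functional_space.subspace_add T_Lie_subspace
        tm_in_T_Lie commutator_tensor_in_T_Lie circ_symmetric_in_T_Lie a b c closed)
qed

end

section \<open>The unitization of the compact operators\<close>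

context normed_space_over
begin

abbreviation "\<K> \<equiv> unitization (compact_operator_algebra sc)"

lemma unitization_simps:
  "elems \<K> = compact_operators sc \<times> UNIV"
  "smul \<K> c (a, s) = (blinfun_scale sc c a, c * s)"
  "mul \<K> (a, s) (b, t) = ((a o\<^sub>L b) + blinfun_scale sc s b + blinfun_scale sc t a, s * t)"
  "nrm \<K> (a, s) = norm a + norm s"
  "unit_elem \<K> = (0, 1)"
  by (simp_all add: unitization_def compact_operator_algebra_def blinfun_scale_def)

lemma blinfun_scale_linear:
  "blinfun_scale sc c (a + b) = blinfun_scale sc c a + blinfun_scale sc c b"
  "blinfun_scale sc (c + d) a = blinfun_scale sc c a + blinfun_scale sc d a"
  "blinfun_scale sc c (blinfun_scale sc d a) = blinfun_scale sc (c * d) a"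
  "blinfun_scale sc 1 a = a" "blinfun_scale sc 0 a = 0" "blinfun_scale sc c 0 = 0"
  by (rule blinfun_eqI, simp add: blinfun.add_left scale_right_distrib scale_left_distrib)+

lemma blinfun_compose_linear:
  "(a + a') o\<^sub>L b = (a o\<^sub>L b) + (a' o\<^sub>L b)" "a o\<^sub>L (b + b') = (a o\<^sub>L b) + (a o\<^sub>L b')"
  "blinfun_scale sc c a o\<^sub>L b = blinfun_scale sc c (a o\<^sub>L b)"
  by (rule blinfun_eqI, simp add: blinfun.add_left blinfun.add_right)+

lemma blinfun_compose_scale_right:
  "a \<in> bounded_operators sc \<Longrightarrow> a o\<^sub>L blinfun_scale sc c b = blinfun_scale sc c (a o\<^sub>L b)"
  by (rule blinfun_eqI) (simp add: bounded_operatorsD)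

lemma blinfun_compose_assoc': "(a o\<^sub>L b) o\<^sub>L c = a o\<^sub>L (b o\<^sub>L c)"
  by (rule blinfun_eqI) simp

lemma uminus_eq_blinfun_scale: "- a = blinfun_scale sc (- 1) a"
  by (rule blinfun_eqI) (simp add: blinfun.minus_left)

lemma unital_normed_algebra_unitization: "unital_normed_algebra \<K>"
proof
  note closed = add_compact_operators scale_compact_operators zero_compact_operators
    compose_compact_operators_left[OF compact_operatorsD(1)]
  show "0 \<in> elems \<K>"
    by (simp add: zero_prod_def unitization_simps closed)
  show "unit_elem \<K> \<in> elems \<K>"
    by (simp add: unitization_simps closed)
  fix a b c :: "('x \<Rightarrow>\<^sub>L 'x) \<times> 'k" and r :: 'k
  obtain x s y t z w where abc: "a = (x, s)" "b = (y, t)" "c = (z, w)"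
    by (metis surj_pair)
  show "0 \<le> nrm \<K> a"
    by (simp add: abc unitization_simps)
  assume a: "a \<in> elems \<K>"
  then have x: "x \<in> compact_operators sc" by (simp add: abc unitization_simps)
  note x' = compact_operatorsD(1)[OF x]
  show "- a \<in> elems \<K>"
    using x by (simp add: abc unitization_simps uminus_eq_blinfun_scale closed)
  show "smul \<K> r a \<in> elems \<K>"
    using x by (simp add: abc unitization_simps closed)
  show "mul \<K> (unit_elem \<K>) a = a" "mul \<K> a (unit_elem \<K>) = a"
    by (simp_all add: abc unitization_simps blinfun_scale_linear)
  show "nrm \<K> (smul \<K> r a) = norm r * nrm \<K> a"
    by (simp add: abc unitization_simps norm_blinfun_scale norm_mult distrib_left)
  assume b: "b \<in> elems \<K>"
  then have y: "y \<in> compact_operators sc" by (simp add: abc unitization_simps)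
  note y' = compact_operatorsD(1)[OF y]
  show "a + b \<in> elems \<K>" "mul \<K> a b \<in> elems \<K>"
    using x y by (simp_all add: abc unitization_simps closed)
  show "mul \<K> (smul \<K> r a) b = smul \<K> r (mul \<K> a b)"
    by (simp add: abc unitization_simps blinfun_scale_linear blinfun_compose_linear mult.commute mult.left_commute)
  show "mul \<K> a (smul \<K> r b) = smul \<K> r (mul \<K> a b)"
    by (simp add: abc unitization_simps blinfun_scale_linear blinfun_compose_scale_right x' mult.commute mult.left_commute)
  show "nrm \<K> (mul \<K> a b) \<le> nrm \<K> a * nrm \<K> b"
  proof -
    have "norm ((x o\<^sub>L y) + blinfun_scale sc s y + blinfun_scale sc t x)
        \<le> norm x * norm y + norm s * norm y + norm t * norm x"
      by (intro norm_triangle_mono norm_blinfun_compose) (simp_all add: norm_blinfun_scale)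
    then show ?thesis
      by (simp add: abc unitization_simps norm_mult algebra_simps)
  qed
  assume "c \<in> elems \<K>"
  show "mul \<K> (a + b) c = mul \<K> a c + mul \<K> b c"
    by (simp add: abc unitization_simps blinfun_scale_linear blinfun_compose_linear algebra_simps)
  show "mul \<K> a (b + c) = mul \<K> a b + mul \<K> a c"
    by (simp add: abc unitization_simps blinfun_scale_linear blinfun_compose_linear algebra_simps)
  show "mul \<K> (mul \<K> a b) c = mul \<K> a (mul \<K> b c)"
    by (simp add: abc unitization_simps blinfun_scale_linear blinfun_compose_linear blinfun_compose_assoc'
        blinfun_compose_scale_right x' mult.commute mult.left_commute add_ac)
qed

sublocale unitization: unital_normed_algebra \<K>
  by (rule unital_normed_algebra_unitization)

lemma finite_rank_unitization_closed:
  "a \<in> finite_rank_operators sc \<times> UNIV \<Longrightarrow> a \<in> elems \<K>"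
  using finite_rank_compact_operators by (auto simp: unitization_simps)

lemma finite_rank_mul_closed:
  assumes "a \<in> finite_rank_operators sc \<times> UNIV" "b \<in> finite_rank_operators sc \<times> UNIV"
  shows "mul \<K> a b \<in> finite_rank_operators sc \<times> UNIV"
proof -
  obtain x s y t where ab: "a = (x, s)" "b = (y, t)" by (metis surj_pair)
  with assms have xy: "x \<in> finite_rank_operators sc" "y \<in> finite_rank_operators sc" by auto
  then have "x \<in> bounded_operators sc" by (simp add: finite_rank_operators_def)
  with xy show ?thesis
    by (simp add: ab unitization_simps add_finite_rank_operators scale_finite_rank_operators
        compose_finite_rank_operators_left)
qed

text \<open>If the tensor were outside \<open>T_Lie\<close>, a functional \<open>l\<close> would
  vanish on \<open>T_Lie\<close> but not at the tensor. Composing \<open>l\<close> with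
  \<open>circ\<close> gives a form covered by \<open>sum_form_zero_if_commutators_cancel\<close>.
  Only operator parts count in it, since a unit on the left gives 0 and a unit on the right gives an
  element of \<open>T_Lie\<close>.\<close>

lemma sum_tp_in_T_Lie:
  assumes "finite I"
    and a: "\<And>i. i \<in> I \<Longrightarrow> a i \<in> finite_rank_operators sc \<times> UNIV"
    and b: "\<And>i. i \<in> I \<Longrightarrow> b i \<in> finite_rank_operators sc \<times> UNIV"
    and ab: "(\<Sum>i\<in>I. mul \<K> (a i) (b i)) = 0" and ba: "(\<Sum>i\<in>I. mul \<K> (b i) (a i)) = 0"
  shows "(\<Sum>i\<in>I. tensor \<K> (opposite \<K>) (a i) (b i)) \<in> T_Lie \<K>"
proof (rule ccontr)
  let ?u = "\<Sum>i\<in>I. tensor \<K> (opposite \<K>) (a i) (b i)"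
  let ?c = unitization.circ
  assume "?u \<notin> T_Lie \<K>"
  then obtain l where l: "Vector_Spaces.linear fun_scale (*) l"
    and l_T: "\<And>t. t \<in> T_Lie \<K> \<Longrightarrow> l t = 0" and l_u: "l ?u \<noteq> 0"
    using subspace_separating_functional[OF unitization.T_Lie_subspace] by blast
  interpret l: Vector_Spaces.linear fun_scale "(*)" l by fact
  define \<beta> where "\<beta> x y = l (?c (x, 0) (y, 0))" for x y
  have mem: "(x, s) \<in> elems \<K>" if "x \<in> finite_rank_operators sc" for x s
    using that by (intro finite_rank_unitization_closed) simp
  note mem0 = mem[where s = 0]
  have add: "(x + y, 0 :: 'k) = (x, 0) + (y, 0)" for x y :: "'x \<Rightarrow>\<^sub>L 'x"
    by simp
  have mul0: "(x o\<^sub>L y, 0) = mul \<K> (x, 0) (y, 0)" for x y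
    by (simp add: unitization_simps blinfun_scale_linear)
  have scale0: "(blinfun_scale sc c x, 0) = smul \<K> c (x, 0)" for c x
    by (simp add: unitization_simps)
  have sum0: "(\<Sum>i\<in>I. \<beta> (fst (a i)) (fst (b i))) = 0"
  proof (rule sum_form_zero_if_commutators_cancel[OF _ _ _ _ \<open>finite I\<close>])
    fix x x' y z c
    assume x: "x \<in> finite_rank_operators sc" and y: "y \<in> finite_rank_operators sc"
    show "\<beta> (blinfun_scale sc c x) y = c * \<beta> x y"
      unfolding \<beta>_def scale0 by (simp add: unitization.circ_smul_left mem0 x y l.scale)
    have "l (?c (x, 0) (y, 0) + ?c (y, 0) (x, 0)) = 0"
      by (intro l_T unitization.circ_symmetric_in_T_Lie mem0 x y)
    then show "\<beta> x y = - \<beta> y x"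
      by (simp add: \<beta>_def l.add eq_neg_iff_add_eq_0)
    assume z: "z \<in> finite_rank_operators sc"
    show "\<beta> (x + y) z = \<beta> x z + \<beta> y z"
      unfolding \<beta>_def add by (simp only: unitization.circ_add_left mem0 x y z l.add)
    show "\<beta> ((x o\<^sub>L y) + (y o\<^sub>L x)) z + \<beta> ((x o\<^sub>L z) + (z o\<^sub>L x)) y + \<beta> ((y o\<^sub>L z) + (z o\<^sub>L y)) x = 0"
      unfolding \<beta>_def add mul0 l.add[symmetric]
      by (intro l_T unitization.circ_jordan_in_T_Lie mem0 x y z)
  next
    show "fst (a i) \<in> finite_rank_operators sc" "fst (b i) \<in> finite_rank_operators sc" if "i \<in> I" for i
      using a[OF that] b[OF that] by auto
    have fst_mul: "fst (mul \<K> p q) = (fst p o\<^sub>L fst q) + (blinfun_scale sc (snd p) (fst q)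
        + blinfun_scale sc (snd q) (fst p))" for p q
      by (cases p; cases q) (simp add: unitization_simps)
    \<comment> \<open>The terms contributed by the scalar parts are the same for both orders of
      multiplication, so they cancel and leave the equation for the operator parts alone.\<close>
    have "(\<Sum>i\<in>I. fst (mul \<K> (a i) (b i))) = (\<Sum>i\<in>I. fst (mul \<K> (b i) (a i)))"
      unfolding fst_sum[symmetric] ab ba ..
    then show "(\<Sum>i\<in>I. fst (a i) o\<^sub>L fst (b i)) = (\<Sum>i\<in>I. fst (b i) o\<^sub>L fst (a i))"
      by (simp add: fst_mul sum.distrib add.commute)
  qed
  have "l (?c (a i) (b i)) = \<beta> (fst (a i)) (fst (b i))" if i: "i \<in> I" for i
  proof -
    obtain x s y t where eq: "a i = (x, s)" "b i = (y, t)" by (metis surj_pair)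
    have x: "x \<in> finite_rank_operators sc" and y: "y \<in> finite_rank_operators sc"
      using a[OF i] b[OF i] eq by auto
    have split: "(x, s) = (x, 0) + smul \<K> s (unit_elem \<K>)" for x s
      by (simp add: unitization_simps blinfun_scale_linear)
    have "?c (x, s) (y, t) = ?c (x, 0) (y, t)"
      by (subst split[of x s])
        (simp add: unitization.circ_add_left unitization.circ_smul_left unitization.circ_unit_left
          mem x y unitization.closed)
    also have "\<dots> = ?c (x, 0) (y, 0) + fun_scale t (unitization.commutator_tensor (x, 0))"
      by (subst split[of y t])
        (simp add: unitization.circ_add_right unitization.circ_smul_right unitization.circ_unit_right
          mem x y unitization.closed)
    finally show ?thesis
      using l_T[OF unitization.commutator_tensor_in_T_Lie[OF mem0[OF x]]]
      by (simp add: eq \<beta>_def l.add l.scale)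
  qed
  then have "(\<Sum>i\<in>I. l (?c (a i) (b i))) = 0"
    using sum0 by simp
  moreover have "?u = (\<Sum>i\<in>I. ?c (a i) (b i))"
  proof -
    have "(\<Sum>i\<in>I. tensor \<K> (opposite \<K>) (unit_elem \<K>) (mul \<K> (a i) (b i)))
        = tensor \<K> (opposite \<K>) (unit_elem \<K>) (\<Sum>i\<in>I. mul \<K> (a i) (b i))"
      using \<open>finite I\<close> a b
      by (intro unitization.tp_sum_right[symmetric] unitization.closed finite_rank_unitization_closed)
    then show ?thesis
      by (simp add: unitization.circ_def sum_subtractf ab unitization.tp_zero unitization.unit_closed)
  qed
  ultimately show False
    using l_u by (simp add: l.sum)
qed

end

section \<open>Completions\<close>

locale seminormed_group =
  fixes V :: "'v::ab_group_add set" and p :: "'v \<Rightarrow> real"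
  assumes diff_closed: "x \<in> V \<Longrightarrow> y \<in> V \<Longrightarrow> x - y \<in> V"
    and seminorm_nonneg: "x \<in> V \<Longrightarrow> 0 \<le> p x"
    and seminorm_zero: "p 0 = 0"
    and seminorm_minus_commute: "x \<in> V \<Longrightarrow> y \<in> V \<Longrightarrow> p (x - y) = p (y - x)"
    and seminorm_triangle: "x \<in> V \<Longrightarrow> y \<in> V \<Longrightarrow> p (x + y) \<le> p x + p y"
begin

lemma seminorm_diff_triangle:
  assumes "x \<in> V" "y \<in> V" "z \<in> V"
  shows "p (x - z) \<le> p (x - y) + p (y - z)"
  using seminorm_triangle[of "x - y" "y - z"] assms by (simp add: diff_closed)

lemma cauchy_seqs_in: "X \<in> cauchy_seqs V p \<Longrightarrow> X n \<in> V"
  by (simp add: cauchy_seqs_def)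

lemma cauchy_seqs_less:
  "X \<in> cauchy_seqs V p \<Longrightarrow> 0 < e \<Longrightarrow> \<exists>N. \<forall>m\<ge>N. \<forall>n\<ge>N. p (X m - X n) < e"
  by (simp add: cauchy_seqs_def)

lemma const_cauchy_seqs: "v \<in> V \<Longrightarrow> (\<lambda>n. v) \<in> cauchy_seqs V p"
  by (simp add: cauchy_seqs_def seminorm_zero)

lemma seminorm_diff_convergent:
  assumes X: "X \<in> cauchy_seqs V p" and Y: "Y \<in> cauchy_seqs V p"
  shows "convergent (\<lambda>n. p (X n - Y n))"
proof -
  have "Cauchy (\<lambda>n. p (X n - Y n))"
  proof (rule metric_CauchyI)
    fix e :: real assume "0 < e"
    then have "0 < e / 2" by simp
    obtain M where M: "\<forall>m\<ge>M. \<forall>n\<ge>M. p (X m - X n) < e / 2"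
      using cauchy_seqs_less[OF X \<open>0 < e / 2\<close>] ..
    obtain N where N: "\<forall>m\<ge>N. \<forall>n\<ge>N. p (Y m - Y n) < e / 2"
      using cauchy_seqs_less[OF Y \<open>0 < e / 2\<close>] ..
    have less: "p (X m - Y m) - p (X n - Y n) < e" if mn: "max M N \<le> m" "max M N \<le> n" for m n
    proof -
      have "p (X m - Y m) \<le> p (X m - X n) + p (X n - Y m)"
        by (intro seminorm_diff_triangle cauchy_seqs_in X Y)
      also have "p (X n - Y m) \<le> p (X n - Y n) + p (Y n - Y m)"
        by (intro seminorm_diff_triangle cauchy_seqs_in X Y)
      finally have "p (X m - Y m) \<le> p (X m - X n) + (p (X n - Y n) + p (Y n - Y m))" by simp
      moreover have "p (X m - X n) < e / 2" "p (Y n - Y m) < e / 2"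
        using M N mn by simp_all
      ultimately show ?thesis by simp
    qed
    have "dist (p (X m - Y m)) (p (X n - Y n)) < e" if "max M N \<le> m" "max M N \<le> n" for m n
      using less[OF that] less[OF that(2,1)] by (simp add: dist_real_def abs_less_iff)
    then show "\<exists>M. \<forall>m\<ge>M. \<forall>n\<ge>M. dist (p (X m - Y m)) (p (X n - Y n)) < e" by blast
  qed
  then show ?thesis by (simp add: Cauchy_convergent_iff)
qed

lemma cauchy_rel_iff:
  "(X, Y) \<in> cauchy_rel V p \<longleftrightarrow>
    X \<in> cauchy_seqs V p \<and> Y \<in> cauchy_seqs V p \<and> (\<lambda>n. p (X n - Y n)) \<longlonglongrightarrow> 0"
  by (auto simp: cauchy_rel_def)

lemma tendsto_zero_mono:
  assumes "\<And>n. 0 \<le> f n" "\<And>n. f n \<le> (g n :: real)" "g \<longlonglongrightarrow> 0"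
  shows "f \<longlonglongrightarrow> 0"
  using assms(1,2) by (intro tendsto_sandwich[OF _ _ tendsto_const assms(3)]) simp_all

lemma cauchy_rel_equiv: "equiv (cauchy_seqs V p) (cauchy_rel V p)"
proof (rule equivI)
  show "cauchy_rel V p \<subseteq> cauchy_seqs V p \<times> cauchy_seqs V p"
    by (auto simp: cauchy_rel_def)
  show "refl_on (cauchy_seqs V p) (cauchy_rel V p)"
    by (auto simp: refl_on_def cauchy_rel_def seminorm_zero)
  show "sym (cauchy_rel V p)"
  proof (rule symI)
    fix X Y assume "(X, Y) \<in> cauchy_rel V p"
    then show "(Y, X) \<in> cauchy_rel V p"
      using seminorm_minus_commute[of "X _" "Y _"] by (simp add: cauchy_rel_iff cauchy_seqs_in)
  qed
  show "trans (cauchy_rel V p)"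
  proof (rule transI)
    fix X Y Z assume XY: "(X, Y) \<in> cauchy_rel V p" and YZ: "(Y, Z) \<in> cauchy_rel V p"
    then have V: "X n \<in> V" "Y n \<in> V" "Z n \<in> V" for n
      by (simp_all add: cauchy_rel_iff cauchy_seqs_in)
    have "(\<lambda>n. p (X n - Y n) + p (Y n - Z n)) \<longlonglongrightarrow> 0"
      using tendsto_add[of "\<lambda>n. p (X n - Y n)" 0 _ "\<lambda>n. p (Y n - Z n)" 0] XY YZ
      by (simp add: cauchy_rel_iff)
    then have "(\<lambda>n. p (X n - Z n)) \<longlonglongrightarrow> 0"
      by (rule tendsto_zero_mono[rotated 2])
        (intro seminorm_nonneg diff_closed V seminorm_diff_triangle)+
    then show "(X, Z) \<in> cauchy_rel V p"
      using XY YZ by (simp add: cauchy_rel_iff)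
  qed
qed

abbreviation "M \<equiv> cauchy_completion V p"
abbreviation "d \<equiv> completion_dist V p"
abbreviation "rep \<xi> \<equiv> (SOME X. X \<in> \<xi>)"

lemma rep_in: assumes "\<xi> \<in> M" shows "rep \<xi> \<in> \<xi>" "rep \<xi> \<in> cauchy_seqs V p"
proof -
  have "\<xi> \<noteq> {}" "\<xi> \<subseteq> cauchy_seqs V p"
    using assms in_quotient_imp_non_empty[OF cauchy_rel_equiv] in_quotient_imp_subset[OF cauchy_rel_equiv]
    unfolding cauchy_completion_def by auto
  then show "rep \<xi> \<in> \<xi>" "rep \<xi> \<in> cauchy_seqs V p"
    using some_in_eq[of \<xi>] by auto
qed

lemma dist_limit:
  assumes "\<xi> \<in> M" "\<eta> \<in> M"
  shows "(\<lambda>n. p (rep \<xi> n - rep \<eta> n)) \<longlonglongrightarrow> d \<xi> \<eta>"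
  using seminorm_diff_convergent[OF rep_in(2)[OF assms(1)] rep_in(2)[OF assms(2)]] assms
  by (simp add: completion_dist_def convergent_LIMSEQ_iff)

lemma rep_V: "\<xi> \<in> M \<Longrightarrow> rep \<xi> n \<in> V"
  by (rule cauchy_seqs_in[OF rep_in(2)])

lemma Metric_space_completion: "Metric_space M d"
proof
  show nonneg: "0 \<le> d \<xi> \<eta>" for \<xi> \<eta>
  proof (cases "\<xi> \<in> M \<and> \<eta> \<in> M")
    case True
    then show ?thesis
      by (intro LIMSEQ_le_const[OF dist_limit]) (auto intro: seminorm_nonneg diff_closed rep_V)
  \<comment> \<open>A metric space structure demands nonnegativity and symmetry for arbitrary
    arguments, hence the default distance 0 outside the completion must be checked.\<close>
  qed (auto simp: completion_dist_def)
  show "d \<xi> \<eta> = d \<eta> \<xi>" for \<xi> \<eta>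
    unfolding completion_dist_def
    using seminorm_minus_commute[OF rep_V rep_V, of \<xi> \<eta>] by auto
  fix \<xi> \<eta> \<zeta> assume xi: "\<xi> \<in> M" and eta: "\<eta> \<in> M"
  show "d \<xi> \<eta> = 0 \<longleftrightarrow> \<xi> = \<eta>"
  proof
    assume "d \<xi> \<eta> = 0"
    with dist_limit[OF xi eta] have "(rep \<xi>, rep \<eta>) \<in> cauchy_rel V p"
      by (simp add: cauchy_rel_iff rep_in(2)[OF xi] rep_in(2)[OF eta])
    then show "\<xi> = \<eta>"
      using quotient_eqI[OF cauchy_rel_equiv] xi eta rep_in(1)[OF xi] rep_in(1)[OF eta]
      unfolding cauchy_completion_def by blast
  next
    assume "\<xi> = \<eta>"
    then show "d \<xi> \<eta> = 0"
      using dist_limit[OF xi xi] by (simp add: seminorm_zero LIMSEQ_const_iff)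
  qed
  assume zeta: "\<zeta> \<in> M"
  show "d \<xi> \<zeta> \<le> d \<xi> \<eta> + d \<eta> \<zeta>"
    by (rule LIMSEQ_le[OF dist_limit[OF xi zeta]
          tendsto_add[OF dist_limit[OF xi eta] dist_limit[OF eta zeta]]])
      (auto intro!: seminorm_diff_triangle rep_V xi eta zeta)
qed

lemma embed_in: "v \<in> V \<Longrightarrow> completion_embed V p v \<in> M"
  unfolding completion_embed_def cauchy_completion_def
  by (intro quotientI const_cauchy_seqs)

lemma rep_embed_limit:
  assumes "v \<in> V"
  shows "(\<lambda>n. p (v - rep (completion_embed V p v) n)) \<longlonglongrightarrow> 0"
proof -
  have "(\<lambda>n. p (v - X n)) \<longlonglongrightarrow> 0" if "X \<in> completion_embed V p v" for X
    using that by (simp add: completion_embed_def cauchy_rel_iff)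
  from this[OF rep_in(1)[OF embed_in[OF assms]]] show ?thesis .
qed

text \<open>The distance is computed from chosen representatives, which need not be the constant
  sequences. They differ from \<open>v\<close> and \<open>w\<close> by amounts tending to 0, so the
  triangle inequality gives the bound in the limit.\<close>

lemma dist_embed_le:
  assumes v: "v \<in> V" and w: "w \<in> V"
  shows "d (completion_embed V p v) (completion_embed V p w) \<le> p (v - w)"
proof -
  let ?X = "rep (completion_embed V p v)" and ?Y = "rep (completion_embed V p w)"
  have XY: "?X n \<in> V" "?Y n \<in> V" for n
    by (rule rep_V[OF embed_in[OF v]], rule rep_V[OF embed_in[OF w]])
  have "(\<lambda>n. p (v - ?X n) + (p (v - w) + p (w - ?Y n))) \<longlonglongrightarrow> 0 + (p (v - w) + 0)"
    by (intro tendsto_intros rep_embed_limit v w)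
  moreover have "p (?X n - ?Y n) \<le> p (v - ?X n) + (p (v - w) + p (w - ?Y n))" for n
    using seminorm_diff_triangle[OF XY(1) v XY(2), of n n] seminorm_diff_triangle[OF v w XY(2), of n]
      seminorm_minus_commute[OF XY(1) v, of n] by simp
  ultimately show ?thesis
    using LIMSEQ_le[OF dist_limit[OF embed_in[OF v] embed_in[OF w]]] by fastforce
qed

lemma embed_in_closure:
  assumes w: "w \<in> V" and T: "T \<subseteq> V" and approx: "\<And>e. 0 < e \<Longrightarrow> \<exists>t\<in>T. p (w - t) < e"
  shows "completion_embed V p w \<in> Metric_space.mtopology M d closure_of (completion_embed V p ` T)"
proof -
  interpret Metric_space M d by (rule Metric_space_completion)
  have "\<exists>y\<in>completion_embed V p ` T. y \<in> mball (completion_embed V p w) r" if r: "0 < r" for r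
  proof -
    obtain t where t: "t \<in> T" "p (w - t) < r" using approx[OF r] by blast
    then have "t \<in> V" using T by blast
    with t dist_embed_le[OF w this] show ?thesis
      by (intro bexI[of _ "completion_embed V p t"]) (auto intro: embed_in w)
  qed
  then show ?thesis
    unfolding metric_closure_of using embed_in[OF w] by blast
qed

end

section \<open>Approximation\<close>

lemma (in unital_normed_algebra) pn_sum_triangle:
  assumes "finite I" "\<And>i. i \<in> I \<Longrightarrow> f i \<in> V"
  shows "pn (\<Sum>i\<in>I. f i) \<le> (\<Sum>i\<in>I. pn (f i))"
proof -
  have "(\<Sum>i\<in>I. f i) \<in> V \<and> pn (\<Sum>i\<in>I. f i) \<le> (\<Sum>i\<in>I. pn (f i))"
    using assms
  proof (induction I)
    case empty
    show ?case by (simp only: sum.empty V_zero pn_zero order_refl simp_thms)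
  next
    case (insert i I)
    then have i: "f i \<in> V" and I: "(\<Sum>i\<in>I. f i) \<in> V" "pn (\<Sum>i\<in>I. f i) \<le> (\<Sum>i\<in>I. pn (f i))" by auto
    show ?case
      unfolding sum.insert[OF insert.hyps] using pn_triangle[OF i I(1)] I(2) V_add[OF i I(1)] by linarith
  qed
  then show ?thesis ..
qed

context normed_space_over
begin

lemma tendsto_fst_mul:
  assumes x: "x \<longlonglongrightarrow> X" and y: "y \<longlonglongrightarrow> Y"
  shows "(\<lambda>j. fst (mul \<K> (x j, s) (y j, t))) \<longlonglongrightarrow> fst (mul \<K> (X, s) (Y, t))"
proof -
  \<comment> \<open>Scalar multiplication becomes composition with a fixed operator, so continuity
    of composition covers all three summands.\<close>
  have scale: "blinfun_scale sc c z = blinfun_scale sc c id_blinfun o\<^sub>L z" for c z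
    by (rule blinfun_eqI) simp
  have comp: "(\<lambda>j. u j o\<^sub>L v j) \<longlonglongrightarrow> (U o\<^sub>L W)" if "u \<longlonglongrightarrow> U" "v \<longlonglongrightarrow> W"
    for u v :: "nat \<Rightarrow> 'x \<Rightarrow>\<^sub>L 'x" and U W
    using bounded_bilinear.tendsto[OF bounded_bilinear_blinfun_compose that] .
  have "(\<lambda>j. (x j o\<^sub>L y j) + (blinfun_scale sc s id_blinfun o\<^sub>L y j) + (blinfun_scale sc t id_blinfun o\<^sub>L x j))
    \<longlonglongrightarrow> (X o\<^sub>L Y) + (blinfun_scale sc s id_blinfun o\<^sub>L Y) + (blinfun_scale sc t id_blinfun o\<^sub>L X)"
    by (intro tendsto_add comp x y tendsto_const)
  then show ?thesis
    by (simp add: unitization_simps scale[symmetric])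
qed

text \<open>
  The approximants keep the scalar parts of the factors; the additional last term
  \<open>1 \<otimes> (- p)\<close> cancels the value \<open>p\<close> of the product on the approximants, which is small.
\<close>

lemma finite_rank_approximation:
  assumes AP: "approximation_property sc"
    and a: "\<And>k. k < n \<Longrightarrow> a k \<in> elems \<K>" and b: "\<And>k. k < n \<Longrightarrow> b k \<in> elems \<K>"
    and pr: "pr = mul \<K> \<or> pr = (\<lambda>x y. mul \<K> y x)"
    and zero: "(\<Sum>k<n. pr (a k) (b k)) = 0"
    and e: "0 < e"
  obtains a' b' where "\<And>k. a' k \<in> finite_rank_operators sc \<times> UNIV"
    "\<And>k. b' k \<in> finite_rank_operators sc \<times> UNIV"
    "(\<Sum>k<Suc n. pr (a' k) (b' k)) = 0"
    "unitization.pn ((\<Sum>k<n. unitization.tp (a k) (b k)) - (\<Sum>k<Suc n. unitization.tp (a' k) (b' k))) < e"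
proof -
  let ?F = "finite_rank_operators sc" and ?tp = unitization.tp and ?N = "nrm \<K>"
  have seq: "\<exists>\<alpha>. (\<forall>j. \<alpha> j \<in> ?F) \<and> (k < n \<longrightarrow> \<alpha> \<longlonglongrightarrow> fst (c k))"
    if "k < n \<Longrightarrow> c k \<in> elems \<K>" for k :: nat and c
  proof (cases "k < n")
    case True
    then have "fst (c k) \<in> compact_operators sc"
      using that by (auto simp: unitization_simps)
    then have "fst (c k) \<in> closure ?F"
      using AP unfolding approximation_property_def by (rule rev_subsetD)
    then show ?thesis
      unfolding closure_sequential by auto
  next
    \<comment> \<open>Indices outside the sum receive the zero sequence, so that the choice function
      is total.\<close>
    case False
    then show ?thesis
      using zero_finite_rank_operators by (intro exI[of _ "\<lambda>_. 0"]) simp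
  qed
  have "\<forall>k. \<exists>\<alpha>. (\<forall>j. \<alpha> j \<in> ?F) \<and> (k < n \<longrightarrow> \<alpha> \<longlonglongrightarrow> fst (a k))"
    using seq a by blast
  from choice[OF this] obtain \<alpha> where
    \<alpha>: "\<And>k j. \<alpha> k j \<in> ?F" "\<And>k. k < n \<Longrightarrow> \<alpha> k \<longlonglongrightarrow> fst (a k)" by auto
  have "\<forall>k. \<exists>\<alpha>. (\<forall>j. \<alpha> j \<in> ?F) \<and> (k < n \<longrightarrow> \<alpha> \<longlonglongrightarrow> fst (b k))"
    using seq b by blast
  from choice[OF this] obtain \<gamma> where
    \<gamma>: "\<And>k j. \<gamma> k j \<in> ?F" "\<And>k. k < n \<Longrightarrow> \<gamma> k \<longlonglongrightarrow> fst (b k)" by auto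
  define A where "A k j = (\<alpha> k j, snd (a k))" for k j
  define C where "C k j = (\<gamma> k j, snd (b k))" for k j
  define P where "P j = (\<Sum>k<n. pr (A k j) (C k j))" for j
  have AF: "A k j \<in> ?F \<times> UNIV" and CF: "C k j \<in> ?F \<times> UNIV" for k j
    using \<alpha>(1) \<gamma>(1) by (simp_all add: A_def C_def)
  note AK = finite_rank_unitization_closed[OF AF] and CK = finite_rank_unitization_closed[OF CF]
  have prF: "pr x y \<in> ?F \<times> UNIV" if "x \<in> ?F \<times> UNIV" "y \<in> ?F \<times> UNIV" for x y
    using pr finite_rank_mul_closed that by metis
  have "fst (P j) \<in> ?F" for j
    unfolding P_def fst_sum using prF[OF AF CF]
    by (induction n) (auto intro!: zero_finite_rank_operators add_finite_rank_operators simp: mem_Times_iff)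
  then have PF: "P j \<in> ?F \<times> UNIV" for j
    by (simp add: mem_Times_iff)
  note PK = finite_rank_unitization_closed[OF PF]
  have snd_pr: "snd (pr x y) = snd x * snd y" for x y
    using pr by (cases x; cases y) (auto simp: unitization_simps mult.commute)
  \<comment> \<open>Because the scalar parts are kept, the scalar part of the error vanishes
    exactly; only its operator part has to tend to 0.\<close>
  have sndP: "snd (P j) = 0" for j
  proof -
    have "snd (P j) = snd (\<Sum>k<n. pr (a k) (b k))"
      unfolding P_def snd_sum snd_pr by (simp add: A_def C_def)
    then show ?thesis by (simp add: zero)
  qed
  have "(\<lambda>j. fst (pr (A k j) (C k j))) \<longlonglongrightarrow> fst (pr (a k) (b k))" if "k < n" for k
  proof -
    have "(\<lambda>j. fst (mul \<K> (A k j) (C k j))) \<longlonglongrightarrow> fst (mul \<K> (a k) (b k))"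
      using tendsto_fst_mul[OF \<alpha>(2)[OF that] \<gamma>(2)[OF that], of "snd (a k)" "snd (b k)"]
      by (simp add: A_def C_def)
    moreover have "(\<lambda>j. fst (mul \<K> (C k j) (A k j))) \<longlonglongrightarrow> fst (mul \<K> (b k) (a k))"
      using tendsto_fst_mul[OF \<gamma>(2)[OF that] \<alpha>(2)[OF that], of "snd (b k)" "snd (a k)"]
      by (simp add: A_def C_def)
    ultimately show ?thesis using pr by auto
  qed
  then have "(\<lambda>j. fst (P j)) \<longlonglongrightarrow> (\<Sum>k<n. fst (pr (a k) (b k)))"
    unfolding P_def fst_sum by (intro tendsto_sum) simp
  then have fstP: "(\<lambda>j. fst (P j)) \<longlonglongrightarrow> 0"
    unfolding fst_sum[symmetric] zero by simp
  have nrm_eq: "?N x = norm (fst x) + norm (snd x)" for x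
    by (cases x) (simp add: unitization_simps)
  \<comment> \<open>\<open>R j\<close> bounds the total error: it comes from splitting
    \<open>a \<otimes> b - A \<otimes> C\<close> into
    \<open>(a - A) \<otimes> b + A \<otimes> (b - C)\<close>, with the correction term
    \<open>1 \<otimes> P\<close> added.\<close>
  define R where "R j = (\<Sum>k<n. ?N (a k - A k j) * ?N (b k) + ?N (A k j) * ?N (b k - C k j)) + ?N (P j)" for j
  have "(\<lambda>j. ?N (a k - A k j)) \<longlonglongrightarrow> 0" "(\<lambda>j. ?N (A k j)) \<longlonglongrightarrow> ?N (a k)"
    "(\<lambda>j. ?N (b k - C k j)) \<longlonglongrightarrow> 0" if "k < n" for k
  proof -
    have "(\<lambda>j. norm (fst (a k) - \<alpha> k j)) \<longlonglongrightarrow> norm (fst (a k) - fst (a k))"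
      "(\<lambda>j. norm (\<alpha> k j) + norm (snd (a k))) \<longlonglongrightarrow> norm (fst (a k)) + norm (snd (a k))"
      "(\<lambda>j. norm (fst (b k) - \<gamma> k j)) \<longlonglongrightarrow> norm (fst (b k) - fst (b k))"
      using that by (intro tendsto_intros \<alpha>(2) \<gamma>(2); simp)+
    then show "(\<lambda>j. ?N (a k - A k j)) \<longlonglongrightarrow> 0" "(\<lambda>j. ?N (A k j)) \<longlonglongrightarrow> ?N (a k)"
      "(\<lambda>j. ?N (b k - C k j)) \<longlonglongrightarrow> 0"
      by (simp_all add: nrm_eq A_def C_def)
  qed
  moreover have "(\<lambda>j. ?N (P j)) \<longlonglongrightarrow> 0"
    using tendsto_norm[OF fstP] by (simp add: nrm_eq sndP)
  ultimately have "R \<longlonglongrightarrow> (\<Sum>k<n. 0 * ?N (b k) + ?N (a k) * 0) + 0"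
    unfolding R_def by (intro tendsto_add tendsto_sum tendsto_mult tendsto_const) simp_all
  then have "R \<longlonglongrightarrow> 0" by simp
  then have "eventually (\<lambda>j. R j < e) sequentially"
    using e by (rule order_tendstoD)
  then obtain j where j: "R j < e"
    by (auto simp: eventually_sequentially)
  \<comment> \<open>Index \<open>n\<close> carries the correction. Its values are repeated beyond
    \<open>n\<close> so that finite rank holds for every index.\<close>
  define a' where "a' k = (if k < n then A k j else unit_elem \<K>)" for k
  define b' where "b' k = (if k < n then C k j else - P j)" for k
  have unitF: "unit_elem \<K> \<in> ?F \<times> UNIV"
    by (simp add: unitization_simps zero_finite_rank_operators)
  have mPF: "- P j \<in> ?F \<times> UNIV"
    using PF[of j] by (simp add: mem_Times_iff uminus_eq_blinfun_scale scale_finite_rank_operators)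
  have sum': "(\<Sum>k<Suc n. f (a' k) (b' k)) = (\<Sum>k<n. f (A k j) (C k j)) + f (unit_elem \<K>) (- P j)"
    for f :: "_ \<Rightarrow> _ \<Rightarrow> 'z::comm_monoid_add"
    by (simp add: a'_def b'_def)
  note unitization.closed[simp] AK[simp] CK[simp] PK[simp] a[simp] b[simp]
  show ?thesis
  proof
    show "a' k \<in> ?F \<times> UNIV" "b' k \<in> ?F \<times> UNIV" for k
      using AF CF unitF mPF by (simp_all add: a'_def b'_def)
    \<comment> \<open>The first factor is the unit, so the same correction works whichever of the
      two products \<open>pr\<close> stands for.\<close>
    have "pr (unit_elem \<K>) (- P j) = - P j"
      using pr unitization.mul_unit_left[of "- P j"] unitization.mul_unit_right[of "- P j"] by auto
    then show "(\<Sum>k<Suc n. pr (a' k) (b' k)) = 0"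
      by (simp add: sum' P_def[symmetric] del: sum.lessThan_Suc)
    have V1: "?tp (a k - A k j) (b k) \<in> unitization.V" and V2: "?tp (A k j) (b k - C k j) \<in> unitization.V"
      if "k < n" for k
      using that unitization.closed(2,3) by (auto intro!: unitization.tp_in_V simp: diff_conv_add_uminus simp del: add_uminus_conv_diff)
    have diff: "?tp (a k) (b k) - ?tp (A k j) (C k j) = ?tp (a k - A k j) (b k) + ?tp (A k j) (b k - C k j)"
      if "k < n" for k
      using that by (simp add: unitization.tp_diff_left unitization.tp_diff_right)
    have total: "(\<Sum>k<n. ?tp (a k) (b k)) - (\<Sum>k<Suc n. ?tp (a' k) (b' k))
      = (\<Sum>k<n. ?tp (a k - A k j) (b k) + ?tp (A k j) (b k - C k j)) + ?tp (unit_elem \<K>) (P j)"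
      by (simp add: sum' unitization.tp_uminus sum_subtractf[symmetric] diff del: sum.lessThan_Suc)
    have "unitization.pn ((\<Sum>k<n. ?tp (a k - A k j) (b k) + ?tp (A k j) (b k - C k j)) + ?tp (unit_elem \<K>) (P j))
      \<le> R j"
    proof -
      have "unitization.pn ((\<Sum>k<n. ?tp (a k - A k j) (b k) + ?tp (A k j) (b k - C k j)) + ?tp (unit_elem \<K>) (P j))
        \<le> unitization.pn (\<Sum>k<n. ?tp (a k - A k j) (b k) + ?tp (A k j) (b k - C k j))
          + unitization.pn (?tp (unit_elem \<K>) (P j))"
        by (intro unitization.pn_triangle unitization.tp_in_V
            functional_space.subspace_sum[OF unitization.V_subspace] unitization.V_add V1 V2) simp_all
      moreover have "unitization.pn (?tp (unit_elem \<K>) (P j)) \<le> ?N (P j)"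
        using unitization.pn_tp_le[OF unitization.unit_closed PK, of j] by (simp add: nrm_eq unitization_simps(5))
      moreover have "unitization.pn (\<Sum>k<n. ?tp (a k - A k j) (b k) + ?tp (A k j) (b k - C k j))
        \<le> (\<Sum>k<n. ?N (a k - A k j) * ?N (b k) + ?N (A k j) * ?N (b k - C k j))"
      proof (rule order_trans[OF unitization.pn_sum_triangle sum_mono])
        fix k assume "k \<in> {..<n}"
        then have k: "k < n" by simp
        have dK: "a k - A k j \<in> elems \<K>" "b k - C k j \<in> elems \<K>"
          using k unitization.add_closed[of "a k" "- A k j"] unitization.add_closed[of "b k" "- C k j"] by simp_all
        show "unitization.pn (?tp (a k - A k j) (b k) + ?tp (A k j) (b k - C k j))
          \<le> ?N (a k - A k j) * ?N (b k) + ?N (A k j) * ?N (b k - C k j)"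
          using unitization.pn_triangle[OF V1[OF k] V2[OF k]]
            unitization.pn_tp_le[OF dK(1) b[OF k]] unitization.pn_tp_le[OF AK dK(2), of k j] by linarith
      qed (auto intro!: unitization.V_add V1 V2)
      ultimately show ?thesis unfolding R_def by linarith
    qed
    with j show "unitization.pn ((\<Sum>k<n. ?tp (a k) (b k)) - (\<Sum>k<Suc n. ?tp (a' k) (b' k))) < e"
      unfolding total by linarith
  qed
qed

text \<open>The error is split as \<open>u (v - v') + (u - u') v'\<close>. Hence \<open>v'\<close>
  is chosen first, with a tolerance depending on the norm of \<open>u\<close>, and \<open>u'\<close>
  afterwards, with a tolerance depending on the norm of \<open>v'\<close>. For \<open>v'\<close> the
  product in the given order is kept at 0, for \<open>u'\<close> the product in the reverse order;
  these are the sums that appear in the middle of the two products of \<open>u' v'\<close>.\<close>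

lemma product_approximation:
  assumes AP: "approximation_property sc" and u: "u \<in> N_Lie \<K>" and v: "v \<in> N_Lie \<K>" and e: "0 < e"
  obtains t where "t \<in> T_Lie \<K>" "unitization.pn (unitization.tm u v - t) < e"
proof -
  let ?F = "finite_rank_operators sc" and ?tp = unitization.tp and ?tm = unitization.tm
    and ?pn = unitization.pn and ?V = unitization.V and ?m = "mul \<K>"
  obtain n :: nat and a b where ab: "\<And>k. k < n \<Longrightarrow> a k \<in> elems \<K>" "\<And>k. k < n \<Longrightarrow> b k \<in> elems \<K>"
    "(\<Sum>k<n. ?m (b k) (a k)) = 0" "u = (\<Sum>k<n. ?tp (a k) (b k))"
    using u unfolding N_Lie_def by auto
  obtain m :: nat and c d where cd: "\<And>k. k < m \<Longrightarrow> c k \<in> elems \<K>" "\<And>k. k < m \<Longrightarrow> d k \<in> elems \<K>"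
    "(\<Sum>k<m. ?m (c k) (d k)) = 0" "v = (\<Sum>k<m. ?tp (c k) (d k))"
    using v unfolding N_Lie_def by auto
  have uV: "u \<in> ?V" and vV: "v \<in> ?V"
    unfolding ab(4) cd(4) by (intro unitization.sum_tp_in_V; simp add: ab cd)+
  \<comment> \<open>With \<open>x + 1\<close> instead of \<open>x\<close> in the divisor, each half
    of the error stays strictly below \<open>e / 2\<close>, also when the norm is 0.\<close>
  have small: "x * (e / (2 * (x + 1))) < e / 2 \<and> 0 < e / (2 * (x + 1))" if "0 \<le> x" for x :: real
    using that e by (simp add: field_simps)
  let ?e1 = "e / (2 * (?pn u + 1))"
  note e1 = small[OF unitization.pn_nonneg[OF uV]]
  obtain c' d' where cd': "\<And>k. c' k \<in> ?F \<times> UNIV" "\<And>k. d' k \<in> ?F \<times> UNIV"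
    "(\<Sum>k<Suc m. ?m (c' k) (d' k)) = 0" "?pn (v - (\<Sum>k<Suc m. ?tp (c' k) (d' k))) < ?e1"
    using finite_rank_approximation[OF AP cd(1,2) disjI1[OF refl] cd(3), of ?e1] e1
    unfolding cd(4)[symmetric] by auto
  define v' where "v' = (\<Sum>k<Suc m. ?tp (c' k) (d' k))"
  note K = finite_rank_unitization_closed
  have v'V: "v' \<in> ?V"
    unfolding v'_def by (intro unitization.sum_tp_in_V K cd') simp
  let ?e2 = "e / (2 * (?pn v' + 1))"
  note e2 = small[OF unitization.pn_nonneg[OF v'V]]
  obtain a' b' where ab': "\<And>k. a' k \<in> ?F \<times> UNIV" "\<And>k. b' k \<in> ?F \<times> UNIV"
    "(\<Sum>k<Suc n. ?m (b' k) (a' k)) = 0" "?pn (u - (\<Sum>k<Suc n. ?tp (a' k) (b' k))) < ?e2"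
    using finite_rank_approximation[OF AP ab(1,2) disjI2[OF refl] ab(3), of ?e2] e2
    unfolding ab(4)[symmetric] by auto
  define u' where "u' = (\<Sum>k<Suc n. ?tp (a' k) (b' k))"
  have u'V: "u' \<in> ?V"
    unfolding u'_def by (intro unitization.sum_tp_in_V K ab') simp
  let ?I = "{..<Suc n} \<times> {..<Suc m}"
  have prod: "?tm u' v' = (\<Sum>p\<in>?I. ?tp (?m (a' (fst p)) (c' (snd p))) (?m (d' (snd p)) (b' (fst p))))"
    unfolding u'_def v'_def by (subst unitization.tm_sum) (simp_all add: K ab' cd' case_prod_unfold)
  have "?tm u' v' \<in> T_Lie \<K>"
    unfolding prod
  proof (rule sum_tp_in_T_Lie)
    have "(\<Sum>p\<in>?I. ?m (?m (a' (fst p)) (c' (snd p))) (?m (d' (snd p)) (b' (fst p))))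
      = (\<Sum>i<Suc n. \<Sum>j<Suc m. ?m (?m (a' i) (c' j)) (?m (d' j) (b' i)))"
      unfolding sum.cartesian_product case_prod_unfold ..
    \<comment> \<open>For fixed \<open>i\<close> the outer factors do not depend on
      \<open>j\<close>, so associativity isolates the vanishing sum attached to
      \<open>v'\<close>.\<close>
    also have "\<dots> = (\<Sum>i<Suc n. ?m (?m (a' i) (\<Sum>j<Suc m. ?m (c' j) (d' j))) (b' i))"
    proof (rule sum.cong[OF refl])
      fix i
      have "?m (?m (a' i) (\<Sum>j<Suc m. ?m (c' j) (d' j))) (b' i)
        = (\<Sum>j<Suc m. ?m (?m (a' i) (?m (c' j) (d' j))) (b' i))"
        using ab'(1,2) cd'(1,2)
        by (simp add: unitization.mul_sum_right unitization.mul_sum_left K unitization.closed del: sum.lessThan_Suc)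
      also have "\<dots> = (\<Sum>j<Suc m. ?m (?m (a' i) (c' j)) (?m (d' j) (b' i)))"
        by (simp add: unitization.mul_assoc K ab' cd' unitization.closed del: sum.lessThan_Suc)
      finally show "(\<Sum>j<Suc m. ?m (?m (a' i) (c' j)) (?m (d' j) (b' i)))
        = ?m (?m (a' i) (\<Sum>j<Suc m. ?m (c' j) (d' j))) (b' i)" ..
    qed
    also have "\<dots> = 0"
      unfolding cd'(3) by (simp add: unitization.mul_zero K ab' del: sum.lessThan_Suc)
    finally show "(\<Sum>p\<in>?I. ?m (?m (a' (fst p)) (c' (snd p))) (?m (d' (snd p)) (b' (fst p)))) = 0" .
    have "(\<Sum>p\<in>?I. ?m (?m (d' (snd p)) (b' (fst p))) (?m (a' (fst p)) (c' (snd p))))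
      = (\<Sum>i<Suc n. \<Sum>j<Suc m. ?m (?m (d' j) (b' i)) (?m (a' i) (c' j)))"
      unfolding sum.cartesian_product case_prod_unfold ..
    \<comment> \<open>In the opposite order the vanishing sum runs over \<open>i\<close>, so the
      summation over \<open>i\<close> has to become the inner one.\<close>
    also have "\<dots> = (\<Sum>j<Suc m. \<Sum>i<Suc n. ?m (?m (d' j) (b' i)) (?m (a' i) (c' j)))"
      by (rule sum.swap)
    also have "\<dots> = (\<Sum>j<Suc m. ?m (?m (d' j) (\<Sum>i<Suc n. ?m (b' i) (a' i))) (c' j))"
    proof (rule sum.cong[OF refl])
      fix j
      have "?m (?m (d' j) (\<Sum>i<Suc n. ?m (b' i) (a' i))) (c' j)
        = (\<Sum>i<Suc n. ?m (?m (d' j) (?m (b' i) (a' i))) (c' j))"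
        using ab'(1,2) cd'(1,2)
        by (simp add: unitization.mul_sum_right unitization.mul_sum_left K unitization.closed del: sum.lessThan_Suc)
      also have "\<dots> = (\<Sum>i<Suc n. ?m (?m (d' j) (b' i)) (?m (a' i) (c' j)))"
        by (simp add: unitization.mul_assoc K ab' cd' unitization.closed del: sum.lessThan_Suc)
      finally show "(\<Sum>i<Suc n. ?m (?m (d' j) (b' i)) (?m (a' i) (c' j)))
        = ?m (?m (d' j) (\<Sum>i<Suc n. ?m (b' i) (a' i))) (c' j)" ..
    qed
    also have "\<dots> = 0"
      unfolding ab'(3) by (simp add: unitization.mul_zero K cd' del: sum.lessThan_Suc)
    finally show "(\<Sum>p\<in>?I. ?m (?m (d' (snd p)) (b' (fst p))) (?m (a' (fst p)) (c' (snd p)))) = 0" .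
  qed (simp_all add: finite_rank_mul_closed ab' cd')
  moreover have "?pn (?tm u v - ?tm u' v') < e"
  proof -
    have "?tm u v - ?tm u' v' = ?tm u (v - v') + ?tm (u - u') v'"
      using uV vV v'V by (simp add: unitization.tm_diff_right unitization.tm_diff_left)
    then have "?pn (?tm u v - ?tm u' v') \<le> ?pn (?tm u (v - v')) + ?pn (?tm (u - u') v')"
      by (simp add: unitization.pn_triangle unitization.tm_in_V unitization.V_diff uV vV u'V v'V)
    also have "\<dots> \<le> ?pn u * ?pn (v - v') + ?pn (u - u') * ?pn v'"
      by (intro add_mono unitization.pn_tm_le unitization.V_diff uV vV u'V v'V)
    also have "\<dots> \<le> ?pn u * ?e1 + ?e2 * ?pn v'"
      using cd'(4) ab'(4) unfolding v'_def[symmetric] u'_def[symmetric]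
      by (intro add_mono mult_left_mono mult_right_mono unitization.pn_nonneg uV v'V) simp_all
    also have "\<dots> < e"
      using e1 e2 by (simp add: mult.commute)
    finally show ?thesis .
  qed
  ultimately show ?thesis by (rule that)
qed

end

section \<open>From single products to their span\<close>

context unital_normed_algebra
begin

sublocale projective: seminormed_group V pn
  by unfold_locales (rule V_diff pn_nonneg pn_zero pn_minus_commute pn_triangle; assumption)+

text \<open>\<open>product_approximation\<close> treats a single product, whereas
  \<open>N_Lie_squared\<close> is a span; the set of tensors approximable from a subspace is again a
  subspace and so contains the span.\<close>

lemma closure_subspace:
  assumes T: "functional_space.subspace T" "T \<subseteq> V"
  shows "functional_space.subspace {w \<in> V. \<forall>e>0. \<exists>t\<in>T. pn (w - t) < e}" (is "functional_space.subspace ?W")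
proof (rule functional_space.subspaceI)
  show "0 \<in> ?W"
    using functional_space.subspace_0[OF T(1)] V_zero pn_zero by force
next
  fix v w assume v: "v \<in> ?W" and w: "w \<in> ?W"
  have "\<exists>t\<in>T. pn (v + w - t) < e" if e: "0 < e" for e
  proof -
    from e have e2: "0 < e / 2" by simp
    obtain s where s: "s \<in> T" "pn (v - s) < e / 2" using v e2 by blast
    obtain t where t: "t \<in> T" "pn (w - t) < e / 2" using w e2 by blast
    have "pn ((v - s) + (w - t)) \<le> pn (v - s) + pn (w - t)"
      using v w s t T(2) by (intro pn_triangle V_diff) auto
    then have "pn (v + w - (s + t)) < e"
      unfolding add_diff_add using s(2) t(2) by linarith
    then show ?thesis
      using functional_space.subspace_add[OF T(1) s(1) t(1)] by blast
  qed
  with v w show "v + w \<in> ?W" using V_add by blast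
next
  fix c w assume w: "w \<in> ?W"
  have "\<exists>t\<in>T. pn (fun_scale c w - t) < e" if e: "0 < e" for e
  proof -
    have c: "0 < norm c + 1" by (simp add: add_nonneg_pos)
    with e have "0 < e / (norm c + 1)" by simp
    then obtain t where t: "t \<in> T" "pn (w - t) < e / (norm c + 1)" using w by blast
    have wt: "w - t \<in> V" using w t T(2) by (intro V_diff) auto
    have "pn (fun_scale c (w - t)) \<le> norm c * pn (w - t)"
      by (rule pn_scale_le[OF wt])
    also have "\<dots> \<le> (norm c + 1) * pn (w - t)"
      by (intro mult_right_mono pn_nonneg[OF wt]) simp
    also have "\<dots> < e"
      using t(2) c by (simp add: field_simps)
    finally have "pn (fun_scale c w - fun_scale c t) < e"
      by (simp only: functional_space.scale_right_diff_distrib)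
    then show ?thesis
      using functional_space.subspace_scale[OF T(1) t(1)] by blast
  qed
  with w show "fun_scale c w \<in> ?W" using V_scale by blast
qed

lemma N_Lie_subset_V: "N_Lie B \<subseteq> V"
  unfolding N_Lie_def by (auto intro!: sum_tp_in_V)

end

theorem theorem4p1:
  fixes sc :: "'k::{real_normed_field, heine_borel} \<Rightarrow> 'x::banach \<Rightarrow> 'x"
    and B :: "('k, ('x \<Rightarrow>\<^sub>L 'x) \<times> 'k) unital_normed_alg"
  assumes "normed_space_over sc"
    and "approximation_property sc"
    and "B = unitization (compact_operator_algebra sc)"
  shows "proj_tensor_embed B (opposite B) ` N_Lie_squared B
    \<subseteq> proj_tensor_topology B (opposite B) closure_of (proj_tensor_embed B (opposite B) ` T_Lie B)"
proof -
  interpret normed_space_over sc by fact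
  let ?V = unitization.V and ?pn = unitization.pn
  \<comment> \<open>The closure of \<open>T_Lie\<close> inside the algebraic tensor product,
    described by the norm alone; the completion appears only in the last step.\<close>
  let ?W = "{w \<in> ?V. \<forall>e>0. \<exists>t\<in>T_Lie \<K>. ?pn (w - t) < e}"
  have "{unitization.tm u v | u v. u \<in> N_Lie \<K> \<and> v \<in> N_Lie \<K>} \<subseteq> ?W"
  proof clarify
    fix u v assume u: "u \<in> N_Lie \<K>" and v: "v \<in> N_Lie \<K>"
    have "unitization.tm u v \<in> ?V"
      using u v unitization.N_Lie_subset_V by (intro unitization.tm_in_V) auto
    then show "unitization.tm u v \<in> ?V \<and> (\<forall>e>0. \<exists>t\<in>T_Lie \<K>. ?pn (unitization.tm u v - t) < e)"
      using product_approximation[OF assms(2) u v] by metis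
  qed
  then have "N_Lie_squared \<K> \<subseteq> ?W"
    unfolding N_Lie_squared_def
    by (rule functional_space.span_minimal)
      (rule unitization.closure_subspace[OF unitization.T_Lie_subspace unitization.T_Lie_subset_V])
  then show ?thesis
    unfolding assms(3) proj_tensor_embed_def proj_tensor_topology_def
    using unitization.projective.embed_in_closure[OF _ unitization.T_Lie_subset_V] by blast
qed

end
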